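(* The generator of a $\mathcal Q$-Markov process determines its distribution. Precisely: fix a collection $\mathcal S$ of simple flows containing exactly one flow connecting $\mathcal A'$ in the sense of ord, for each finite sub-semilattice $\mathcal A'$ and each consistent ordering ord of $\mathcal A'$. Let $\mathcal Q$ and $\tilde{\mathcal Q}$ be transition systems on $\mathcal A(u)$, $X$ a $\mathcal Q$-Markov process and $\tilde X$ a $\tilde{\mathcal Q}$-Markov process with the same initial distribution, both having generators (with respect to $\mathcal S$) in the sense of the context. If the generators of $X$ and $\tilde X$ coincide, then $X$ and $\tilde X$ have the same finite dimensional distributions.
   Context: Framework. $T$ is a compact Hausdorff space and $\mathcal A$ is a collection of closed connected subsets of $T$ with $\emptyset,T\in\mathcal A$, closed under arbitrary intersections, containing no two disjoint non-empty sets, and separable from above: there are finite subcollections $\mathcal A_n\subseteq\mathcal A_{n+1}\subseteq\mathcal A$ closed under intersections and maps $g_n$ sending each $A\in\mathcal A$ to a finite union of sets of $\mathcal A_n$ with $A=\cap_n g_n(A)$, $g_{n+1}(A)\subseteq g_n(A)$, $A\subseteq g_n(A)^0$ (interior), $g_n(\emptyset)=\emptyset$, $g_n(\cap_\alpha A_\alpha)=\cap_\alpha g_n(A_\alpha)$ for arbitrary families, and $\cup_{i=1}^kA_i=\cup_{j=1}^mA'_j\Rightarrow\cup_{i=1}^kg_n(A_i)=\cup_{j=1}^mg_n(A'_j)$. Put $\emptyset'=\cap_{A\in\mathcal A\setminus\{\emptyset\}}A$ (a non-empty set). $\mathcal A(u)$ is the class of finite unions of sets of $\mathcal A$; $\mathcal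 C$ is the class of sets $A\setminus B$ with $A\in\mathcal A$, $B\in\mathcal A(u)$; $\mathcal C(u)$ is the class of finite unions of sets of $\mathcal C$. A finite sub-semilattice is a non-empty finite collection $\mathcal A'\subseteq\mathcal A$ of non-empty sets closed under intersections. A consistent ordering of $\mathcal A'$ is a list $\{A_0=\emptyset',A_1,\ldots,A_n\}$ where $A_1,\ldots,A_n$ enumerates the distinct sets of $\mathcal A'$, $A_1=\cap_{A\in\mathcal A'}A$ (possibly $A_1=A_0$), and every $A\in\mathcal A'$ with $A\subsetneq A_{i+1}$ is one of $A_1,\ldots,A_i$. Flows. A flow is an increasing map $f:[0,a]\to\mathcal A(u)$ (or on any compact interval). It is continuous if $f(t)=\cap_nf(t_n)$ for $t_n\downarrow t$ and $f(t)=\overline{\cup_nf(t_n)}$ for $t_n\uparrow t$. It is simple if it is continuous and there are $0=t_0<\cdots<t_n=a$ and flows $f_{i+1}:[t_i,t_{i+1}]\to\mathcal A$ with $f(0)=\emptyset'$ and $f(t)=\cup_{j=1}^if_j(t_j)\cup f_{i+1}(t)$ for $t\in[t_i,t_{i+1}]$. A simple flow connects the sets of $\mathcal A'$ in the sense of the consistent ordering $\{A_0=\emptyset',\ldots,A_n\}$ if the $f_{i+1}$ can be taken continuous with $f_{i+1}(t_{i+1})=A_{i+1}$, $f_1(0)=\emptyset'$ and $f_{i+1}(t_i)\subseteq\cup_{j=0}^iA_j$, so that $f(t_i)=\cup_{j=0}^iA_j$. It is a known fact of the framework (Ivanoff–Merzbach) that such a flow exists for every $\mathcal A'$ and every consistent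 ordering. Processes. A process $X=(X_A)_{A\in\mathcal A}$ is a family of real random variables on a complete probability space. It has a (almost surely) unique additive extension to $\mathcal A(u)$ if, whenever $\cup_{i=1}^nA_i=\cup_{j=1}^mA'_j$ with all sets in $\mathcal A$, the inclusion–exclusion sums $\sum_iX_{A_i}-\sum_{i_1<i_2}X_{A_{i_1}\cap A_{i_2}}+\cdots+(-1)^{n+1}X_{A_1\cap\cdots\cap A_n}$ and the analogous sum for the $A'_j$ coincide a.s.; the common value is $X_B$, $B=\cup_iA_i$. It has a unique additive extension to $\mathcal C$ if $A\setminus B=A'\setminus B'$ ($A,A'\in\mathcal A$, $B,B'\in\mathcal A(u)$) implies $X_A-X_{A\cap B}=X_{A'}-X_{A'\cap B'}$ a.s., the common value being $X_{A\setminus B}$ (in particular $X_\emptyset=0$ a.s.). A unique additive extension to $\mathcal C(u)$ means the analogous inclusion–exclusion consistency for finite unions of sets of $\mathcal C$. The minimal filtration is $\mathcal F_B=\sigma(X_A;A\in\mathcal A,A\subseteq B)$, $B\in\mathcal A(u)$ (completed). The initial distribution of $X$ is the law of $X_{\emptyset'}$. A transition system $\mathcal Q=(Q_{BB'})$ is a family of transition probabilities on $\mathbf R$ indexed by pairs $B\subseteq B'$ of non-empty sets in $\mathcal A(u)$ with $Q_{BB}(x;\cdot)=\delta_x$ and $Q_{BB''}(x;\Gamma)=\int_{\mathbf R}Q_{B'B''}(y;\Gamma)Q_{BB'}(x;dy)$ for $B\subseteq B'\subseteq B''$. A process with a unique additive extension to $\mathcal C(u)$ is $\mathcal Q$-Markov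 if $P[X_{B'}\in\Gamma\mid\mathcal F_B]=Q_{BB'}(X_B;\Gamma)$ a.s. for all non-empty $B\subseteq B'$ in $\mathcal A(u)$ and Borel $\Gamma$. Generator. $B(\mathbf R)$ is the Banach space of bounded measurable functions $\mathbf R\to\mathbf R$ with the supremum norm. For $f\in\mathcal S$ put $Q^f_{st}=Q_{f(s),f(t)}$ and $(T^f_{st}h)(x)=\int_{\mathbf R}h(y)Q^f_{st}(x;dy)$, $s\le t$. Standing assumption: there is a subspace $\mathcal D$, dense in $B(\mathbf R)$ and common to all $f\in\mathcal S$, such that $T^f_{st}(\mathcal D)\subseteq\mathcal D$, for each $h\in\mathcal D$ the function $T^f_{st}h$ is strongly continuously differentiable with respect to $s$ and to $t$, and $-(\frac{\partial^-}{\partial r}T^f_{rs}h)|_{r=s}=(\frac{\partial^+}{\partial t}T^f_{st}h)|_{t=s}$ for all $s$. This common value is denoted $\mathcal G^f_sh$, and the operator $\mathcal G^f_s$ has domain $\mathcal D$. The collection $\{(\mathcal G^f_s)_s;f\in\mathcal S\}$ is the generator of $X$. *)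

theory Defs
  imports "HOL-Probability.Probability"
begin

section \<open>Indexing collections\<close>

definition fin_unions :: "'a set set \<Rightarrow> 'a set set" where
  "fin_unions \<V> = {\<Union>\<B> | \<B>. finite \<B> \<and> \<B> \<subseteq> \<V>}"

definition separable_from_above :: "'t::topological_space set set \<Rightarrow> bool" where
  "separable_from_above \<A> \<longleftrightarrow>
    (\<exists>(\<A>n :: nat \<Rightarrow> 't set set) (g :: nat \<Rightarrow> 't set \<Rightarrow> 't set).
      (\<forall>n. finite (\<A>n n) \<and> \<A>n n \<subseteq> \<A>n (Suc n) \<and> \<A>n n \<subseteq> \<A>) \<and>
      (\<forall>n. \<forall>A\<in>\<A>n n. \<forall>B\<in>\<A>n n. A \<inter> B \<in> \<A>n n) \<and>
      (\<forall>n. \<forall>A\<in>\<A>. g n A \<in> fin_unions (\<A>n n)) \<and>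
      (\<forall>A\<in>\<A>. A = (\<Inter>n. g n A)) \<and>
      (\<forall>n. \<forall>A\<in>\<A>. g (Suc n) A \<subseteq> g n A) \<and>
      (\<forall>n. \<forall>A\<in>\<A>. A \<subseteq> interior (g n A)) \<and>
      (\<forall>n. g n {} = {}) \<and>
      (\<forall>n. \<forall>\<B>. \<B> \<subseteq> \<A> \<and> \<B> \<noteq> {} \<longrightarrow> g n (\<Inter>\<B>) = (\<Inter>A\<in>\<B>. g n A)) \<and>
      (\<forall>n. \<forall>\<B> \<B>'. finite \<B> \<and> \<B> \<subseteq> \<A> \<and> finite \<B>' \<and> \<B>' \<subseteq> \<A> \<and> \<Union>\<B> = \<Union>\<B>' \<longrightarrow>
        (\<Union>A\<in>\<B>. g n A) = (\<Union>A\<in>\<B>'. g n A)))"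

text \<open>The compact Hausdorff space is the whole type, a \<^class>\<open>t2_space\<close>.\<close>

definition indexing_collection :: "'t::t2_space set set \<Rightarrow> bool" where
  "indexing_collection \<A> \<longleftrightarrow>
    compact (UNIV :: 't set) \<and>
    (\<forall>A\<in>\<A>. closed A \<and> connected A) \<and>
    {} \<in> \<A> \<and> UNIV \<in> \<A> \<and>
    (\<forall>\<B>. \<B> \<subseteq> \<A> \<and> \<B> \<noteq> {} \<longrightarrow> \<Inter>\<B> \<in> \<A>) \<and>
    (\<forall>A\<in>\<A>. \<forall>B\<in>\<A>. A \<noteq> {} \<and> B \<noteq> {} \<longrightarrow> A \<inter> B \<noteq> {}) \<and>
    separable_from_above \<A>"

definition least_set :: "'t set set \<Rightarrow> 't set" where
  "least_set \<A> = \<Inter>(\<A> - {{}})"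

definition diff_sets :: "'t set set \<Rightarrow> 't set set" where
  "diff_sets \<A> = {A - B | A B. A \<in> \<A> \<and> B \<in> fin_unions \<A>}"

definition finite_subsemilattice :: "'t set set \<Rightarrow> 't set set \<Rightarrow> bool" where
  "finite_subsemilattice \<A> \<A>' \<longleftrightarrow>
    finite \<A>' \<and> \<A>' \<noteq> {} \<and> \<A>' \<subseteq> \<A> \<and> {} \<notin> \<A>' \<and> (\<forall>A\<in>\<A>'. \<forall>B\<in>\<A>'. A \<inter> B \<in> \<A>')"

text \<open>An ordering is the list \<open>[A\<^sub>0, A\<^sub>1, \<dots>, A\<^sub>n]\<close>; repetition is possible only between
  \<open>A\<^sub>0\<close> and \<open>A\<^sub>1\<close>.\<close>

definition consistent_ordering :: "'t set set \<Rightarrow> 't set set \<Rightarrow> 't set list \<Rightarrow> bool" where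
  "consistent_ordering \<A> \<A>' ord \<longleftrightarrow>
    finite_subsemilattice \<A> \<A>' \<and>
    ord \<noteq> [] \<and> ord ! 0 = least_set \<A> \<and>
    distinct (tl ord) \<and> set (tl ord) = \<A>' \<and>
    ord ! 1 = \<Inter>\<A>' \<and>
    (\<forall>i. Suc i < length ord \<longrightarrow>
      (\<forall>A\<in>\<A>'. A \<subset> ord ! Suc i \<longrightarrow> (\<exists>j\<in>{1..i}. A = ord ! j)))"


section \<open>Flows\<close>

text \<open>A pair \<open>(a, f)\<close> is a flow on \<open>[0, a]\<close>; the values of \<open>f\<close> outside \<open>[0, a]\<close> are never
  used.\<close>

type_synonym 't flow = "real \<times> (real \<Rightarrow> 't set)"

definition flow_on :: "'t set set \<Rightarrow> real \<Rightarrow> real \<Rightarrow> (real \<Rightarrow> 't set) \<Rightarrow> bool" where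
  "flow_on \<V> a b f \<longleftrightarrow> (\<forall>t\<in>{a..b}. f t \<in> \<V>) \<and> mono_on {a..b} f"

definition continuous_flow_on :: "real \<Rightarrow> real \<Rightarrow> (real \<Rightarrow> 't::topological_space set) \<Rightarrow> bool" where
  "continuous_flow_on a b f \<longleftrightarrow>
    (\<forall>t\<in>{a..b}. \<forall>\<tau>. range \<tau> \<subseteq> {a..b} \<and> \<tau> \<longlonglongrightarrow> t \<longrightarrow>
      (decseq \<tau> \<longrightarrow> f t = (\<Inter>n. f (\<tau> n))) \<and>
      (incseq \<tau> \<longrightarrow> f t = closure (\<Union>n. f (\<tau> n))))"

definition flow_pieces ::
    "'t set set \<Rightarrow> 't flow \<Rightarrow> nat \<Rightarrow> (nat \<Rightarrow> real) \<Rightarrow> (nat \<Rightarrow> real \<Rightarrow> 't set) \<Rightarrow> bool" where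
  "flow_pieces \<A> F n \<tau> \<phi> \<longleftrightarrow>
    \<tau> 0 = 0 \<and> \<tau> n = fst F \<and> (\<forall>i<n. \<tau> i < \<tau> (Suc i)) \<and>
    snd F 0 = least_set \<A> \<and>
    (\<forall>i<n. flow_on \<A> (\<tau> i) (\<tau> (Suc i)) (\<phi> (Suc i)) \<and>
      (\<forall>t\<in>{\<tau> i..\<tau> (Suc i)}. snd F t = (\<Union>j\<in>{1..i}. \<phi> j (\<tau> j)) \<union> \<phi> (Suc i) t))"

definition simple_flow :: "'t::topological_space set set \<Rightarrow> 't flow \<Rightarrow> bool" where
  "simple_flow \<A> F \<longleftrightarrow>
    flow_on (fin_unions \<A>) 0 (fst F) (snd F) \<and> continuous_flow_on 0 (fst F) (snd F) \<and>
    (\<exists>n \<tau> \<phi>. flow_pieces \<A> F n \<tau> \<phi>)"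

definition connects ::
    "'t::topological_space set set \<Rightarrow> 't flow \<Rightarrow> 't set set \<Rightarrow> 't set list \<Rightarrow> bool" where
  "connects \<A> F \<A>' ord \<longleftrightarrow>
    simple_flow \<A> F \<and> consistent_ordering \<A> \<A>' ord \<and>
    (\<exists>\<tau> \<phi>. flow_pieces \<A> F (length ord - 1) \<tau> \<phi> \<and>
      \<phi> 1 0 = least_set \<A> \<and>
      (\<forall>i<length ord - 1.
        continuous_flow_on (\<tau> i) (\<tau> (Suc i)) (\<phi> (Suc i)) \<and>
        \<phi> (Suc i) (\<tau> (Suc i)) = ord ! Suc i \<and>
        \<phi> (Suc i) (\<tau> i) \<subseteq> (\<Union>j\<le>i. ord ! j)))"

text \<open>One flow is selected for each pair \<open>(\<A>', ord)\<close>. The same flow may connect several pairs (if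
  a flow connecting \<open>{A}\<close> passes through \<open>B\<close> with \<open>least_set \<A> \<subset> B \<subset> A\<close>, it also connects \<open>{B, A}\<close>), so \<open>\<S>\<close> may contain
  flows connecting \<open>(\<A>', ord)\<close> besides the one selected for it. If \<open>\<exists>!F\<in>\<S>. connects \<A> F \<A>' ord\<close>
  for all pairs, then the unique flows form such a collection.\<close>

definition flow_collection :: "'t::topological_space set set \<Rightarrow> 't flow set \<Rightarrow> bool" where
  "flow_collection \<A> \<S> \<longleftrightarrow>
    (\<exists>sel. (\<forall>\<A>' ord. consistent_ordering \<A> \<A>' ord \<longrightarrow> connects \<A> (sel \<A>' ord) \<A>' ord) \<and>
      \<S> = {sel \<A>' ord | \<A>' ord. consistent_ordering \<A> \<A>' ord})"


section \<open>Set-indexed processes and their additive extensions\<close>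

definition process :: "'t set set \<Rightarrow> 'w measure \<Rightarrow> ('t set \<Rightarrow> 'w \<Rightarrow> real) \<Rightarrow> bool" where
  "process \<A> M X \<longleftrightarrow>
    prob_space M \<and> complete_measure M \<and> (\<forall>A\<in>\<A>. X A \<in> borel_measurable M)"

definition incl_excl :: "('t set \<Rightarrow> 'w \<Rightarrow> real) \<Rightarrow> 't set list \<Rightarrow> 'w \<Rightarrow> real" where
  "incl_excl X As \<omega> =
    (\<Sum>J | J \<subseteq> {..<length As} \<and> J \<noteq> {}. (- 1) ^ (card J + 1) * X (\<Inter>j\<in>J. As ! j) \<omega>)"

definition incl_excl_consistent ::
    "'t set set \<Rightarrow> 'w measure \<Rightarrow> ('t set \<Rightarrow> 'w \<Rightarrow> real) \<Rightarrow> bool" where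
  "incl_excl_consistent \<V> M X \<longleftrightarrow>
    (\<forall>As As'. As \<noteq> [] \<and> As' \<noteq> [] \<and> set As \<subseteq> \<V> \<and> set As' \<subseteq> \<V> \<and> \<Union>(set As) = \<Union>(set As') \<longrightarrow>
      (AE \<omega> in M. incl_excl X As \<omega> = incl_excl X As' \<omega>))"

text \<open>The values \<open>X\<^sub>B\<close> for \<open>B \<in> \<A>(u)\<close> and \<open>X\<^sub>C\<close> for \<open>C \<in> \<C>\<close>. The representation of the set is
  chosen arbitrarily; under \<open>additive_extension\<close> below the result does not depend on this choice,
  up to a null set.\<close>

definition ext_u :: "'t set set \<Rightarrow> ('t set \<Rightarrow> 'w \<Rightarrow> real) \<Rightarrow> 't set \<Rightarrow> 'w \<Rightarrow> real" where
  "ext_u \<A> X B =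
    (SOME Y. \<exists>As. As \<noteq> [] \<and> set As \<subseteq> \<A> \<and> \<Union>(set As) = B \<and> Y = incl_excl X As)"

definition ext_diff :: "'t set set \<Rightarrow> ('t set \<Rightarrow> 'w \<Rightarrow> real) \<Rightarrow> 't set \<Rightarrow> 'w \<Rightarrow> real" where
  "ext_diff \<A> X C =
    (SOME Y. \<exists>A\<in>\<A>. \<exists>B\<in>fin_unions \<A>. C = A - B \<and> Y = (\<lambda>\<omega>. X A \<omega> - ext_u \<A> X (A \<inter> B) \<omega>))"

text \<open>The second clause is what makes \<^const>\<open>ext_diff\<close> an extension of \<open>X\<close>: both \<open>A = A - {}\<close>
  and \<open>{} = A - A\<close> belong to \<open>\<C>\<close>.\<close>

definition additive_extension ::
    "'t set set \<Rightarrow> 'w measure \<Rightarrow> ('t set \<Rightarrow> 'w \<Rightarrow> real) \<Rightarrow> bool" where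
  "additive_extension \<A> M X \<longleftrightarrow>
    incl_excl_consistent \<A> M X \<and>
    (AE \<omega> in M. X {} \<omega> = 0) \<and>
    (\<forall>A\<in>\<A>. \<forall>A'\<in>\<A>. \<forall>B\<in>fin_unions \<A>. \<forall>B'\<in>fin_unions \<A>. A - B = A' - B' \<longrightarrow>
      (AE \<omega> in M. X A \<omega> - ext_u \<A> X (A \<inter> B) \<omega> = X A' \<omega> - ext_u \<A> X (A' \<inter> B') \<omega>)) \<and>
    incl_excl_consistent (diff_sets \<A>) M (ext_diff \<A> X)"

definition minimal_filtration ::
    "'t set set \<Rightarrow> 'w measure \<Rightarrow> ('t set \<Rightarrow> 'w \<Rightarrow> real) \<Rightarrow> 't set \<Rightarrow> 'w measure" where
  "minimal_filtration \<A> M X B =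
    sigma (space M)
      ({X A -` \<Gamma> \<inter> space M | A \<Gamma>. A \<in> \<A> \<and> A \<subseteq> B \<and> \<Gamma> \<in> sets borel} \<union> null_sets M)"

definition same_fdd ::
    "'t set set \<Rightarrow> 'w measure \<Rightarrow> ('t set \<Rightarrow> 'w \<Rightarrow> real) \<Rightarrow> 'v measure \<Rightarrow> ('t set \<Rightarrow> 'v \<Rightarrow> real) \<Rightarrow> bool"
  where
  "same_fdd \<A> M X N Y \<longleftrightarrow>
    (\<forall>I. finite I \<and> I \<subseteq> \<A> \<longrightarrow>
      distr M (\<Pi>\<^sub>M A\<in>I. borel) (\<lambda>\<omega>. \<lambda>A\<in>I. X A \<omega>) =
      distr N (\<Pi>\<^sub>M A\<in>I. borel) (\<lambda>\<omega>. \<lambda>A\<in>I. Y A \<omega>))"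


section \<open>Transition systems and the Markov property\<close>

type_synonym 't transitions = "'t set \<Rightarrow> 't set \<Rightarrow> real \<Rightarrow> real measure"

definition transition_system :: "'t set set \<Rightarrow> 't transitions \<Rightarrow> bool" where
  "transition_system \<A> Q \<longleftrightarrow>
    (\<forall>B\<in>fin_unions \<A> - {{}}. \<forall>B'\<in>fin_unions \<A>. B \<subseteq> B' \<longrightarrow>
      Q B B' \<in> borel \<rightarrow>\<^sub>M prob_algebra borel) \<and>
    (\<forall>B\<in>fin_unions \<A> - {{}}. \<forall>x. Q B B x = return borel x) \<and>
    (\<forall>B\<in>fin_unions \<A> - {{}}. \<forall>B'\<in>fin_unions \<A>. \<forall>B''\<in>fin_unions \<A>. B \<subseteq> B' \<and> B' \<subseteq> B'' \<longrightarrow>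
      (\<forall>x. \<forall>\<Gamma>\<in>sets borel.
        emeasure (Q B B'' x) \<Gamma> = (\<integral>\<^sup>+ y. emeasure (Q B' B'' y) \<Gamma> \<partial>Q B B' x)))"

definition markov_process ::
    "'t set set \<Rightarrow> 't transitions \<Rightarrow> 'w measure \<Rightarrow> ('t set \<Rightarrow> 'w \<Rightarrow> real) \<Rightarrow> bool" where
  "markov_process \<A> Q M X \<longleftrightarrow>
    process \<A> M X \<and> additive_extension \<A> M X \<and>
    (\<forall>B\<in>fin_unions \<A> - {{}}. \<forall>B'\<in>fin_unions \<A>. B \<subseteq> B' \<longrightarrow> (\<forall>\<Gamma>\<in>sets borel.
      AE \<omega> in M.
        real_cond_exp M (minimal_filtration \<A> M X B)
          (indicator {\<omega>' \<in> space M. ext_u \<A> X B' \<omega>' \<in> \<Gamma>}) \<omega> =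
        measure (Q B B' (ext_u \<A> X B \<omega>)) \<Gamma>))"


section \<open>The Banach space of bounded measurable functions\<close>

typedef bmfun = "{h :: real \<Rightarrow> real. h \<in> borel_measurable borel \<and> bounded (range h)}"
  morphisms apply_bmfun Bmfun
  by (rule exI[of _ "\<lambda>_. 0"]) (auto simp: image_def)

setup_lifting type_definition_bmfun

lemma borel_measurable_apply_bmfun [measurable, simp]: "apply_bmfun h \<in> borel_measurable borel"
  and bounded_apply_bmfun [simp]: "bounded (range (apply_bmfun h))"
  using apply_bmfun[of h] by auto

lemma bmfun_eqI: "(\<And>x. apply_bmfun h x = apply_bmfun k x) \<Longrightarrow> h = k"
  by (metis apply_bmfun_inverse ext)

instantiation bmfun :: real_vector
begin

lift_definition zero_bmfun :: bmfun is "\<lambda>_. 0"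
  by (auto simp: image_def)

lift_definition uminus_bmfun :: "bmfun \<Rightarrow> bmfun" is "\<lambda>h x. - h x"
  by auto

lift_definition plus_bmfun :: "bmfun \<Rightarrow> bmfun \<Rightarrow> bmfun" is "\<lambda>h k x. h x + k x"
  by (auto intro: bounded_plus_comp)

lift_definition minus_bmfun :: "bmfun \<Rightarrow> bmfun \<Rightarrow> bmfun" is "\<lambda>h k x. h x - k x"
  by (auto intro: bounded_minus_comp)

lift_definition scaleR_bmfun :: "real \<Rightarrow> bmfun \<Rightarrow> bmfun" is "\<lambda>r h x. r * h x"
  by (auto dest: bounded_scaleR_comp simp flip: real_scaleR_def)

instance
  by standard (transfer; simp add: algebra_simps fun_eq_iff)+

end

instantiation bmfun :: real_normed_vector
begin

lift_definition norm_bmfun :: "bmfun \<Rightarrow> real" is "\<lambda>h. SUP x. \<bar>h x\<bar>" .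

definition dist_bmfun :: "bmfun \<Rightarrow> bmfun \<Rightarrow> real" where
  "dist_bmfun h k = norm (h - k)"

definition sgn_bmfun :: "bmfun \<Rightarrow> bmfun" where
  "sgn_bmfun h = h /\<^sub>R norm h"

definition uniformity_bmfun :: "(bmfun \<times> bmfun) filter" where
  "uniformity_bmfun = (INF e\<in>{0<..}. principal {(h, k). dist h k < e})"

definition open_bmfun :: "bmfun set \<Rightarrow> bool" where
  "open_bmfun S = (\<forall>h\<in>S. \<forall>\<^sub>F (h', k) in uniformity. h' = h \<longrightarrow> k \<in> S)"

lemma abs_le_norm_bmfun: "\<bar>apply_bmfun h x\<bar> \<le> norm h"
proof transfer
  fix h :: "real \<Rightarrow> real" and x
  assume "h \<in> borel_measurable borel \<and> bounded (range h)"
  then have "bdd_above (range (\<lambda>x. \<bar>h x\<bar>))"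
    unfolding bounded_iff bdd_above_def by auto
  then show "\<bar>h x\<bar> \<le> (SUP x. \<bar>h x\<bar>)"
    by (rule cSUP_upper[OF UNIV_I])
qed

lemma norm_bmfun_le: "(\<And>x. \<bar>apply_bmfun h x\<bar> \<le> c) \<Longrightarrow> norm h \<le> c"
  by transfer (auto intro: cSUP_least)

instance
proof
  fix r :: real and h k :: bmfun
  show "norm h = 0 \<longleftrightarrow> h = 0"
  proof
    assume "norm h = 0"
    then have "apply_bmfun h x = 0" for x
      using abs_le_norm_bmfun[of h x] by simp
    then show "h = 0"
      by (intro bmfun_eqI) (simp add: zero_bmfun.rep_eq)
  qed (auto simp: norm_bmfun.rep_eq zero_bmfun.rep_eq)
  show "norm (h + k) \<le> norm h + norm k"
  proof (rule norm_bmfun_le)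
    fix x
    show "\<bar>apply_bmfun (h + k) x\<bar> \<le> norm h + norm k"
      using abs_le_norm_bmfun[of h x] abs_le_norm_bmfun[of k x] by (simp add: plus_bmfun.rep_eq)
  qed
  have scale: "norm (c *\<^sub>R h') \<le> \<bar>c\<bar> * norm h'" for c and h' :: bmfun
  proof (rule norm_bmfun_le)
    fix x
    show "\<bar>apply_bmfun (c *\<^sub>R h') x\<bar> \<le> \<bar>c\<bar> * norm h'"
      using abs_le_norm_bmfun[of h' x]
      by (simp add: scaleR_bmfun.rep_eq abs_mult mult_left_mono)
  qed
  show "norm (r *\<^sub>R h) = \<bar>r\<bar> * norm h"
  proof (cases "r = 0")
    case True
    then show ?thesis
      by (simp add: norm_bmfun.rep_eq zero_bmfun.rep_eq)
  next
    case False
    have "\<bar>r\<bar> * norm h = \<bar>r\<bar> * norm (inverse r *\<^sub>R (r *\<^sub>R h))"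
      using False by simp
    also have "\<dots> \<le> \<bar>r\<bar> * (\<bar>inverse r\<bar> * norm (r *\<^sub>R h))"
      by (intro mult_left_mono scale) simp
    also have "\<dots> = norm (r *\<^sub>R h)"
      using False by (simp add: field_simps)
    finally show ?thesis
      using scale[of r h] by simp
  qed
qed (auto simp: dist_bmfun_def sgn_bmfun_def uniformity_bmfun_def open_bmfun_def)

end

instance bmfun :: banach
proof
  fix h :: "nat \<Rightarrow> bmfun"
  assume h: "Cauchy h"
  have le: "\<bar>apply_bmfun (h m) x - apply_bmfun (h n) x\<bar> \<le> dist (h m) (h n)" for m n x
    using abs_le_norm_bmfun[of "h m - h n" x] by (simp add: dist_bmfun_def minus_bmfun.rep_eq)
  have "Cauchy (\<lambda>n. apply_bmfun (h n) x)" for x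
    using h le unfolding Cauchy_def dist_real_def by (meson le_less_trans)
  then have "\<exists>l. (\<lambda>n. apply_bmfun (h n) x) \<longlonglongrightarrow> l" for x
    by (simp add: real_Cauchy_convergent convergentD)
  then obtain k where k: "\<And>x. (\<lambda>n. apply_bmfun (h n) x) \<longlonglongrightarrow> k x"
    by metis
  have unif: "\<bar>apply_bmfun (h m) x - k x\<bar> \<le> e" if "\<forall>n\<ge>N. dist (h m) (h n) < e" for m x e N
  proof (rule LIMSEQ_le_const2)
    show "(\<lambda>n. \<bar>apply_bmfun (h m) x - apply_bmfun (h n) x\<bar>) \<longlonglongrightarrow> \<bar>apply_bmfun (h m) x - k x\<bar>"
      by (intro tendsto_intros k)
    show "\<exists>N. \<forall>n\<ge>N. \<bar>apply_bmfun (h m) x - apply_bmfun (h n) x\<bar> \<le> e"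
      using that le by (meson le_less_trans less_imp_le)
  qed
  have meas: "k \<in> borel_measurable borel"
    by (rule borel_measurable_LIMSEQ_real[OF k]) auto
  obtain N where N: "\<forall>m\<ge>N. \<forall>n\<ge>N. dist (h m) (h n) < 1"
    using metric_CauchyD[OF h, of 1] by auto
  have "\<bar>k x\<bar> \<le> norm (h N) + 1" for x
    using unif[of N N 1 x] N abs_le_norm_bmfun[of "h N" x] by auto
  then have bdd: "bounded (range k)"
    unfolding bounded_iff by (auto intro!: exI[of _ "norm (h N) + 1"])
  have rep: "apply_bmfun (Bmfun k) = k"
    using meas bdd by (intro Bmfun_inverse) auto
  have "h \<longlonglongrightarrow> Bmfun k"
  proof (rule metric_LIMSEQ_I)
    fix e :: real
    assume "0 < e"
    then obtain N where N: "\<forall>m\<ge>N. \<forall>n\<ge>N. dist (h m) (h n) < e / 2"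
      using metric_CauchyD[OF h, of "e / 2"] by auto
    have "dist (h m) (Bmfun k) < e" if "m \<ge> N" for m
    proof -
      have "dist (h m) (Bmfun k) \<le> e / 2"
        unfolding dist_bmfun_def
        using unif[of N m "e / 2"] N that
        by (intro norm_bmfun_le) (simp add: minus_bmfun.rep_eq rep)
      then show ?thesis
        using \<open>0 < e\<close> by simp
    qed
    then show "\<exists>N. \<forall>n\<ge>N. dist (h n) (Bmfun k) < e"
      by blast
  qed
  then show "convergent h"
    by (rule convergentI)
qed

lifting_update bmfun.lifting
lifting_forget bmfun.lifting


section \<open>Generators\<close>

definition trans_op :: "'t transitions \<Rightarrow> 't flow \<Rightarrow> real \<Rightarrow> real \<Rightarrow> bmfun \<Rightarrow> bmfun" where
  "trans_op Q F s t h = Bmfun (\<lambda>x. \<integral>y. apply_bmfun h y \<partial>Q (snd F s) (snd F t) x)"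

lemma apply_trans_op:
  assumes Q: "Q (snd F s) (snd F t) \<in> borel \<rightarrow>\<^sub>M prob_algebra borel"
  shows "apply_bmfun (trans_op Q F s t h) x = (\<integral>y. apply_bmfun h y \<partial>Q (snd F s) (snd F t) x)"
proof -
  let ?Q = "Q (snd F s) (snd F t)"
  have Q': "?Q \<in> borel \<rightarrow>\<^sub>M subprob_algebra borel"
    using Q by (rule measurable_prob_algebraD)
  have meas: "(\<lambda>x. \<integral>y. apply_bmfun h y \<partial>?Q x) \<in> borel_measurable borel"
    by (rule measurable_compose[OF Q' integral_measurable_subprob_algebra]) simp
  have "\<bar>\<integral>y. apply_bmfun h y \<partial>?Q x\<bar> \<le> norm h" for x
  proof -
    have "?Q x \<in> space (prob_algebra borel)"
      using measurable_space[OF Q, of x] by simp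
    then interpret prob_space "?Q x"
      by (simp add: space_prob_algebra)
    have "sets (?Q x) = sets borel"
      using \<open>?Q x \<in> space (prob_algebra borel)\<close> by (simp add: space_prob_algebra)
    then have "apply_bmfun h \<in> borel_measurable (?Q x)"
      by (simp cong: measurable_cong_sets)
    then have int: "integrable (?Q x) (apply_bmfun h)"
      by (intro integrable_const_bound[where B = "norm h"]) (auto simp: abs_le_norm_bmfun)
    have "\<bar>\<integral>y. apply_bmfun h y \<partial>?Q x\<bar> \<le> (\<integral>y. \<bar>apply_bmfun h y\<bar> \<partial>?Q x)"
      by (rule integral_abs_bound)
    also have "\<dots> \<le> (\<integral>y. norm h \<partial>?Q x)"
      using int by (intro integral_mono) (auto simp: abs_le_norm_bmfun)
    finally show ?thesis
      by (simp add: prob_space)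
  qed
  then have "bounded (range (\<lambda>x. \<integral>y. apply_bmfun h y \<partial>?Q x))"
    unfolding bounded_iff by auto
  with meas show ?thesis
    by (simp add: trans_op_def Bmfun_inverse)
qed

definition continuously_differentiable_on ::
    "real set \<Rightarrow> (real \<Rightarrow> 'b::real_normed_vector) \<Rightarrow> bool" where
  "continuously_differentiable_on I u \<longleftrightarrow>
    (\<exists>u'. (\<forall>t\<in>I. (u has_vector_derivative u' t) (at t within I)) \<and> continuous_on I u')"

definition forward_derivative :: "'t transitions \<Rightarrow> 't flow \<Rightarrow> real \<Rightarrow> bmfun \<Rightarrow> bmfun" where
  "forward_derivative Q F s h = vector_derivative (\<lambda>t. trans_op Q F s t h) (at_right s)"

definition backward_derivative :: "'t transitions \<Rightarrow> 't flow \<Rightarrow> real \<Rightarrow> bmfun \<Rightarrow> bmfun" where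
  "backward_derivative Q F s h = vector_derivative (\<lambda>r. trans_op Q F r s h) (at_left s)"

text \<open>At the end points of \<open>[0, a]\<close> only one of the two one-sided derivatives makes sense, so their
  agreement is required in the interior, and the generator at an end point is given by the
  derivative that exists there.\<close>

definition has_generator :: "'t flow set \<Rightarrow> 't transitions \<Rightarrow> bmfun set \<Rightarrow> bool" where
  "has_generator \<S> Q D \<longleftrightarrow>
    subspace D \<and> closure D = UNIV \<and>
    (\<forall>F\<in>\<S>. \<forall>h\<in>D.
      (\<forall>s t. 0 \<le> s \<and> s \<le> t \<and> t \<le> fst F \<longrightarrow> trans_op Q F s t h \<in> D) \<and>
      (\<forall>t\<in>{0..fst F}. continuously_differentiable_on {0..t} (\<lambda>s. trans_op Q F s t h)) \<and>
      (\<forall>s\<in>{0..fst F}. continuously_differentiable_on {s..fst F} (\<lambda>t. trans_op Q F s t h)) \<and>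
      (\<forall>s\<in>{0<..<fst F}. - backward_derivative Q F s h = forward_derivative Q F s h))"

text \<open>As a partial function, so that equality of generators includes equality of domains.\<close>

definition generator ::
    "'t transitions \<Rightarrow> bmfun set \<Rightarrow> 't flow \<Rightarrow> real \<Rightarrow> bmfun \<rightharpoonup> bmfun" where
  "generator Q D F s =
    (\<lambda>h. if s < fst F then Some (forward_derivative Q F s h)
         else Some (- backward_derivative Q F s h)) |` D"

end

theory Submission
  imports Defs
begin

text \<open>Both halves of the argument run along a simple flow \<open>f\<close> that connects a finite
  sub-semilattice \<open>\<A>'\<close> containing the sets of interest.

  Along \<open>f\<close> the transition operators form a two-parameter evolution family of contractions
  \<open>T s t\<close>, and the generator \<open>G s\<close> satisfies the forward equation \<open>\<partial>\<^sub>t T s t h = T s t (G t h)\<close>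
  and the backward equation \<open>\<partial>\<^sub>s T s t h = - G s (T s t h)\<close> on the domain \<open>\<D>\<close>. If a second family
  \<open>T'\<close> has the same generator, then \<open>r \<mapsto> T s r (T' r t h)\<close> has derivative
  \<open>T s r (G r (T' r t h)) - T s r (G r (T' r t h)) = 0\<close>, and comparing its values at \<open>s\<close> and \<open>t\<close>
  gives \<open>T' s t h = T s t h\<close>. Density of \<open>\<D>\<close> extends this to all bounded measurable functions;
  indicators then show that the two transition systems have the same kernels along \<open>f\<close>
  (\<open>evolution_determined_by_generator\<close>, \<open>transition_kernels_eq\<close>).

  If \<open>A\<^sub>0, \<dots>, A\<^sub>n\<close> is a consistent ordering of \<open>\<A>'\<close>, the flow passes through
  \<open>B\<^sub>k = A\<^sub>0 \<union> \<dots> \<union> A\<^sub>k\<close>. By the Markov property the values of the process on \<open>B\<^sub>0, \<dots>, B\<^sub>n\<close> form a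
  Markov chain, whose law depends only on the initial distribution and on the kernels from
  \<open>B\<^sub>k\<close> to \<open>B\<^sub>k\<^sub>+\<^sub>1\<close> (\<open>markov_chain_law_eq\<close>). Consistency of the ordering makes every
  intersection of \<open>A\<^sub>k\<close> with an earlier set an earlier set, so that
  inclusion-exclusion can be solved for the values on \<open>A\<^sub>0, \<dots>, A\<^sub>n\<close>: they are linear combinations
  of the values on \<open>B\<^sub>0, \<dots>, B\<^sub>n\<close>, with coefficients that do not depend on the process
  (\<open>lin_comb_nth\<close>). The finite dimensional distributions are therefore one and the same image of
  the law of the chain for both processes (\<open>fdd_as_image_of_chain_law\<close>).\<close>

section \<open>Evolution families are determined by their generators\<close>

lemma at_right_vector_derivative:
  fixes f :: "real \<Rightarrow> 'b::real_normed_vector"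
  assumes "(f has_vector_derivative d) (at r within {r..b})" and "r < b"
  shows "vector_derivative f (at_right r) = d"
  using assms by (intro vector_derivative_within) (auto simp: at_within_Icc_at_right)

lemma at_left_vector_derivative:
  fixes f :: "real \<Rightarrow> 'b::real_normed_vector"
  assumes "(f has_vector_derivative d) (at r within {b..r})" and "b < r"
  shows "vector_derivative f (at_left r) = d"
  using assms by (intro vector_derivative_within) (auto simp: at_within_Icc_at_left)

lemma continuously_differentiable_on_imp_continuous_on:
  "continuously_differentiable_on I u \<Longrightarrow> continuous_on I u"
  unfolding continuously_differentiable_on_def by (blast intro: continuous_on_vector_derivative)

text \<open>The properties of the operators of a transition system along one flow on \<open>[0, a]\<close>, stated for an
  arbitrary normed space. \<open>derivatives_agree\<close> compares the one-sided derivatives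
  as \<open>vector_derivative\<close> values; by \<open>C1_left\<close> and \<open>C1_right\<close> both derivatives exist.\<close>

locale contraction_evolution =
  fixes a :: real
    and T :: "real \<Rightarrow> real \<Rightarrow> 'b::real_normed_vector \<Rightarrow> 'b"
    and D :: "'b set"
  assumes linear_T: "0 \<le> s \<Longrightarrow> s \<le> t \<Longrightarrow> t \<le> a \<Longrightarrow> linear (T s t)"
    and norm_T_le: "0 \<le> s \<Longrightarrow> s \<le> t \<Longrightarrow> t \<le> a \<Longrightarrow> norm (T s t h) \<le> norm h"
    and T_refl: "0 \<le> s \<Longrightarrow> s \<le> a \<Longrightarrow> T s s h = h"
    and T_comp: "0 \<le> r \<Longrightarrow> r \<le> s \<Longrightarrow> s \<le> t \<Longrightarrow> t \<le> a \<Longrightarrow> T r s (T s t h) = T r t h"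
    and dense_D: "closure D = UNIV"
    and T_in_D: "h \<in> D \<Longrightarrow> 0 \<le> s \<Longrightarrow> s \<le> t \<Longrightarrow> t \<le> a \<Longrightarrow> T s t h \<in> D"
    and C1_left: "h \<in> D \<Longrightarrow> 0 \<le> t \<Longrightarrow> t \<le> a \<Longrightarrow>
      continuously_differentiable_on {0..t} (\<lambda>s. T s t h)"
    and C1_right: "h \<in> D \<Longrightarrow> 0 \<le> s \<Longrightarrow> s \<le> a \<Longrightarrow>
      continuously_differentiable_on {s..a} (\<lambda>t. T s t h)"
    and derivatives_agree: "h \<in> D \<Longrightarrow> 0 < s \<Longrightarrow> s < a \<Longrightarrow>
      - vector_derivative (\<lambda>r. T r s h) (at_left s) = vector_derivative (\<lambda>t. T s t h) (at_right s)"
begin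

definition gen :: "real \<Rightarrow> 'b \<Rightarrow> 'b" where
  "gen s h = vector_derivative (\<lambda>t. T s t h) (at_right s)"

lemma bounded_linear_T: "0 \<le> s \<Longrightarrow> s \<le> t \<Longrightarrow> t \<le> a \<Longrightarrow> bounded_linear (T s t)"
  using linear_T norm_T_le
  by (intro bounded_linear_intro[where K = 1]) (auto simp: linear_add linear_scale)

text \<open>For \<open>h\<close> in the domain this is part of differentiability; contractivity makes the approximation of
  a general \<open>h\<close> by elements of the domain uniform in \<open>t\<close>.\<close>

lemma continuous_on_T:
  assumes "0 \<le> s" "s \<le> a"
  shows "continuous_on {s..a} (\<lambda>t. T s t h)"
proof -
  have "h \<in> closure D" by (simp add: dense_D)
  then obtain k where k: "\<And>n. k n \<in> D" "k \<longlonglongrightarrow> h"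
    by (auto simp: closure_sequential)
  show ?thesis
  proof (rule uniform_limit_theorem[where F = sequentially and f = "\<lambda>n t. T s t (k n)"])
    have "continuous_on {s..a} (\<lambda>t. T s t (k n))" for n
      using C1_right[OF k(1) assms] by (rule continuously_differentiable_on_imp_continuous_on)
    then show "\<forall>\<^sub>F n in sequentially. continuous_on {s..a} (\<lambda>t. T s t (k n))"
      by simp
    show "uniform_limit {s..a} (\<lambda>n t. T s t (k n)) (\<lambda>t. T s t h) sequentially"
    proof (rule uniform_limitI)
      fix e :: real assume "0 < e"
      from tendstoD[OF k(2) this]
      show "\<forall>\<^sub>F n in sequentially. \<forall>t\<in>{s..a}. dist (T s t (k n)) (T s t h) < e"
      proof eventually_elim
        case (elim n)
        show ?case
        proof
          fix t assume t: "t \<in> {s..a}"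
          then have "dist (T s t (k n)) (T s t h) = norm (T s t (k n - h))"
            using linear_T[of s t] assms by (simp add: dist_norm linear_diff)
          also have "\<dots> \<le> dist (k n) h"
            using norm_T_le[of s t] t assms by (simp add: dist_norm)
          finally show "dist (T s t (k n)) (T s t h) < e" using elim by simp
        qed
      qed
    qed
  qed simp
qed

text \<open>The right derivative comes from \<open>T s t = T s r \<circ> T r t\<close> and continuity of \<open>T s r\<close>. The
  two-sided statement then follows because \<open>C1_right\<close> provides some derivative, which has to agree with
  the right one.\<close>

lemma forward_equation:
  assumes h: "h \<in> D" and r: "0 \<le> s" "s \<le> r" "r < a"
  shows "((\<lambda>t. T s t h) has_vector_derivative T s r (gen r h)) (at r within {s..a})"
proof -
  obtain d where d: "((\<lambda>t. T s t h) has_vector_derivative d) (at r within {s..a})"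
    using C1_right[of h s] h r unfolding continuously_differentiable_on_def by fastforce
  obtain e where e: "((\<lambda>t. T r t h) has_vector_derivative e) (at r within {r..a})"
    using C1_right[of h r] h r unfolding continuously_differentiable_on_def by fastforce
  have "gen r h = e"
    unfolding gen_def using e r by (intro at_right_vector_derivative) auto
  have "((\<lambda>t. T s r (T r t h)) has_vector_derivative T s r e) (at r within {r..a})"
    using bounded_linear.has_vector_derivative[OF bounded_linear_T e, of s r] r by simp
  then have "((\<lambda>t. T s t h) has_vector_derivative T s r e) (at r within {r..a})"
    by (rule has_vector_derivative_transform[rotated -1]) (use T_comp r in auto)
  moreover have "((\<lambda>t. T s t h) has_vector_derivative d) (at r within {r..a})"
    using d by (rule has_vector_derivative_within_subset) (use r in auto)
  ultimately have "T s r e = d"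
    using at_right_vector_derivative \<open>r < a\<close> by metis
  then show ?thesis
    using d \<open>gen r h = e\<close> by simp
qed

text \<open>Symmetric to \<open>forward_equation\<close>: here \<open>T s t h = T s r (T r t h)\<close> gives the left derivative at \<open>r\<close>
  as that of \<open>s \<mapsto> T s r k\<close> with \<open>k = T r t h\<close>, and this is \<open>- gen r k\<close> by
  \<open>derivatives_agree\<close>. Invariance of the domain is needed for \<open>k \<in> D\<close>.\<close>

lemma backward_equation:
  assumes h: "h \<in> D" and r: "0 < r" "r < t" "t \<le> a"
  shows "((\<lambda>s. T s t h) has_vector_derivative - gen r (T r t h)) (at r within {0..t})"
proof -
  define k where "k = T r t h"
  have k: "k \<in> D" using T_in_D h r by (simp add: k_def)
  obtain d where d: "((\<lambda>s. T s t h) has_vector_derivative d) (at r within {0..t})"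
    using C1_left[of h t] h r unfolding continuously_differentiable_on_def by fastforce
  obtain e where e: "((\<lambda>s. T s r k) has_vector_derivative e) (at r within {0..r})"
    using C1_left[of k r] k r unfolding continuously_differentiable_on_def by fastforce
  have "- gen r k = e"
    using at_left_vector_derivative[OF e] derivatives_agree[OF k] r
    unfolding gen_def by (metis less_le_trans minus_minus)
  have "((\<lambda>s. T s t h) has_vector_derivative e) (at r within {0..r})"
    using e by (rule has_vector_derivative_transform[rotated -1]) (use T_comp r in \<open>auto simp: k_def\<close>)
  moreover have "((\<lambda>s. T s t h) has_vector_derivative d) (at r within {0..r})"
    using d by (rule has_vector_derivative_within_subset) (use r in auto)
  ultimately have "e = d"
    using at_left_vector_derivative \<open>0 < r\<close> by metis
  then show ?thesis
    using d \<open>- gen r k = e\<close> by (simp add: k_def)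
qed

text \<open>A product rule for operators that are only strongly differentiable. The increment of
  \<open>q \<mapsto> T s q (g q)\<close> is split so that the differentiated vector in the second part is the fixed
  \<open>g r\<close>, and the first part is controlled by contractivity and strong continuity at \<open>g'\<close>.\<close>

lemma product_rule:
  assumes s: "0 \<le> s" "s \<le> r" "r \<le> t" "t \<le> a"
    and g: "(g has_vector_derivative g') (at r within {s..t})"
    and d: "((\<lambda>q. T s q (g r)) has_vector_derivative d) (at r within {s..t})"
  shows "((\<lambda>q. T s q (g q)) has_vector_derivative T s r g' + d) (at r within {s..t})"
proof -
  define \<rho> where "\<rho> q = norm (g q - g r - (q - r) *\<^sub>R g') / norm (q - r)" for q
  define \<sigma> where "\<sigma> q = norm (T s q (g r) - T s r (g r) - (q - r) *\<^sub>R d) / norm (q - r)" for q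
  define \<kappa> where "\<kappa> q = norm (T s q g' - T s r g')" for q
  let ?e = "\<lambda>q. norm (T s q (g q) - T s r (g r) - (q - r) *\<^sub>R (T s r g' + d)) / norm (q - r)"
  let ?F = "at r within {s..t}"
  have "(\<rho> \<longlongrightarrow> 0) ?F" "(\<sigma> \<longlongrightarrow> 0) ?F"
    using g d by (simp_all add: has_vector_derivative_def has_derivative_iff_norm \<rho>_def[abs_def] \<sigma>_def[abs_def])
  moreover have "(\<kappa> \<longlongrightarrow> 0) ?F"
  proof -
    have "continuous_on {s..t} (\<lambda>q. T s q g')"
      by (rule continuous_on_subset[OF continuous_on_T]) (use s in auto)
    then have "((\<lambda>q. T s q g') \<longlongrightarrow> T s r g') ?F"
      using s by (simp add: continuous_on_def)
    then show ?thesis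
      unfolding \<kappa>_def by (auto intro!: tendsto_norm_zero simp: LIM_zero_iff)
  qed
  ultimately have lim: "((\<lambda>q. \<rho> q + \<kappa> q + \<sigma> q) \<longlongrightarrow> 0) ?F"
    by (auto intro!: tendsto_add_zero)
  have bound: "?e q \<le> \<rho> q + \<kappa> q + \<sigma> q" if q: "q \<in> {s..t}" "q \<noteq> r" for q
  proof -
    have lin: "linear (T s q)" using q s by (intro linear_T) auto
    \<comment> \<open>the three summands lead to the bounds \<open>\<rho>\<close>, \<open>\<kappa>\<close> and \<open>\<sigma>\<close>\<close>
    have "T s q (g q) - T s r (g r) - (q - r) *\<^sub>R (T s r g' + d) =
        T s q (g q - g r - (q - r) *\<^sub>R g') + (q - r) *\<^sub>R (T s q g' - T s r g') +
        (T s q (g r) - T s r (g r) - (q - r) *\<^sub>R d)"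
      by (simp add: linear_diff[OF lin] linear_add[OF lin] linear_scale[OF lin] algebra_simps)
    also have "norm \<dots> \<le> norm (g q - g r - (q - r) *\<^sub>R g') + norm (q - r) * \<kappa> q +
        norm (T s q (g r) - T s r (g r) - (q - r) *\<^sub>R d)"
      unfolding \<kappa>_def using q s
      by (intro norm_triangle_mono norm_T_le order_refl) auto
    finally have "?e q \<le> (norm (g q - g r - (q - r) *\<^sub>R g') + norm (q - r) * \<kappa> q +
        norm (T s q (g r) - T s r (g r) - (q - r) *\<^sub>R d)) / norm (q - r)"
      by (rule divide_right_mono) simp
    also have "\<dots> = \<rho> q + \<kappa> q + \<sigma> q"
      using q by (simp add: \<rho>_def \<sigma>_def add_divide_distrib)
    finally show ?thesis .
  qed
  have "(?e \<longlongrightarrow> 0) ?F"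
    using lim
  proof (rule tendsto_sandwich[OF _ _ tendsto_const, rotated 2])
    show "\<forall>\<^sub>F q in ?F. ?e q \<le> \<rho> q + \<kappa> q + \<sigma> q"
      unfolding eventually_at_filter by (intro always_eventually) (use bound in blast)
  qed auto
  then show ?thesis
    by (simp add: has_vector_derivative_def has_derivative_iff_norm bounded_linear_scaleR_left)
qed

lemma continuous_product:
  assumes s: "0 \<le> s" "t \<le> a" and g: "continuous_on {s..t} g"
  shows "continuous_on {s..t} (\<lambda>q. T s q (g q))"
  unfolding continuous_on_def
proof
  fix r assume r: "r \<in> {s..t}"
  let ?F = "at r within {s..t}"
  have "continuous_on {s..t} (\<lambda>q. T s q (g r))"
    by (rule continuous_on_subset[OF continuous_on_T]) (use s r in auto)
  then have "((\<lambda>q. T s q (g r)) \<longlongrightarrow> T s r (g r)) ?F"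
    using r by (simp add: continuous_on_def)
  moreover have "((\<lambda>q. T s q (g q) - T s q (g r)) \<longlongrightarrow> 0) ?F"
  proof (rule Lim_null_comparison)
    have "norm (T s q (g q) - T s q (g r)) \<le> norm (g q - g r)" if "q \<in> {s..t}" for q
      using linear_diff[OF linear_T[of s q], of "g q" "g r"] norm_T_le[of s q "g q - g r"] that s by simp
    then show "\<forall>\<^sub>F q in ?F. norm (T s q (g q) - T s q (g r)) \<le> norm (g q - g r)"
      unfolding eventually_at_filter by (intro always_eventually) blast
    show "((\<lambda>q. norm (g q - g r)) \<longlongrightarrow> 0) ?F"
      using g r by (auto intro!: tendsto_norm_zero simp: LIM_zero_iff continuous_on_def)
  qed
  ultimately show "((\<lambda>q. T s q (g q)) \<longlongrightarrow> T s r (g r)) ?F"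
    using tendsto_add[of "\<lambda>q. T s q (g r)" "T s r (g r)" ?F "\<lambda>q. T s q (g q) - T s q (g r)" 0]
    by simp
qed

end

text \<open>The interpolation \<open>u r = T s r (T' r t h)\<close> joins \<open>T' s t h\<close> to \<open>T s t h\<close>, and the forward equation for
  \<open>T\<close> cancels the backward equation for \<open>T'\<close>. The mean value theorem asks for derivatives only
  strictly between \<open>s\<close> and \<open>t\<close>, which is why the generators are compared at interior times.\<close>

theorem evolution_determined_by_generator:
  assumes "contraction_evolution a T D" and "contraction_evolution a T' D"
    and gen: "\<And>r h. 0 < r \<Longrightarrow> r < a \<Longrightarrow> h \<in> D \<Longrightarrow>
      contraction_evolution.gen T r h = contraction_evolution.gen T' r h"
    and s: "0 \<le> s" "s \<le> t" "t \<le> a"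
  shows "T s t = T' s t"
proof -
  interpret E: contraction_evolution a T D by fact
  interpret E': contraction_evolution a T' D by fact
  have on_D: "T s t h = T' s t h" if h: "h \<in> D" for h
  proof (cases "s = t")
    case True
    then show ?thesis using s E.T_refl E'.T_refl by simp
  next
    case False
    then have "s < t" using s by simp
    define u where "u r = T s r (T' r t h)" for r
    have "norm (u t - u s) \<le> 0 - 0"
    proof (rule differentiable_bound_general[OF \<open>s < t\<close>, where f' = "\<lambda>_. 0" and \<phi>' = "\<lambda>_. 0"])
      have "continuous_on {0..t} (\<lambda>r. T' r t h)"
        using E'.C1_left[OF h, of t] s
        by (simp add: continuously_differentiable_on_imp_continuous_on)
      then have "continuous_on {s..t} (\<lambda>r. T' r t h)"
        by (rule continuous_on_subset) (use s in auto)
      then show "continuous_on {s..t} u"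
        unfolding u_def using s by (intro E.continuous_product)
    next
      fix r assume r: "s < r" "r < t"
      let ?k = "T' r t h"
      have k: "?k \<in> D" using E'.T_in_D h r s by simp
      have "((\<lambda>q. T' q t h) has_vector_derivative - E'.gen r ?k) (at r within {s..t})"
        by (rule has_vector_derivative_within_subset[OF E'.backward_equation]) (use h r s in auto)
      moreover have "((\<lambda>q. T s q ?k) has_vector_derivative T s r (E.gen r ?k)) (at r within {s..t})"
        by (rule has_vector_derivative_within_subset[OF E.forward_equation]) (use k r s in auto)
      ultimately have "(u has_vector_derivative T s r (- E'.gen r ?k) + T s r (E.gen r ?k)) (at r within {s..t})"
        unfolding u_def using r s by (intro E.product_rule) auto
      moreover have "T s r (- E'.gen r ?k) + T s r (E.gen r ?k) = 0"
        using gen[of r ?k] k r s E.linear_T[of s r] by (simp add: linear_neg)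
      ultimately show "(u has_vector_derivative 0) (at r)"
        using r by (simp add: at_within_Icc_at)
    qed auto
    then show ?thesis
      using s by (simp add: u_def E.T_refl E'.T_refl)
  qed
  show ?thesis
  proof
    fix h
    have "continuous_on UNIV (T s t)" "continuous_on UNIV (T' s t)"
      using E.bounded_linear_T E'.bounded_linear_T s by (simp_all add: linear_continuous_on)
    then have "closed {h. T s t h = T' s t h}"
      by (intro closed_Collect_eq)
    then have "closure D \<subseteq> {h. T s t h = T' s t h}"
      using on_D by (intro closure_minimal) auto
    then show "T s t h = T' s t h"
      using E.dense_D by auto
  qed
qed

section \<open>Transition operators along a flow\<close>

lemma mem_fin_unions: "A \<in> \<A> \<Longrightarrow> A \<in> fin_unions \<A>"
  unfolding fin_unions_def by (intro CollectI exI[of _ "{A}"]) auto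

lemma transition_kernel:
  assumes Q: "transition_system \<A> Q"
    and B: "B \<in> fin_unions \<A>" "B \<noteq> {}" "B' \<in> fin_unions \<A>" "B \<subseteq> B'"
  shows "Q B B' \<in> borel \<rightarrow>\<^sub>M prob_algebra borel"
proof -
  have "\<forall>B\<in>fin_unions \<A> - {{}}. \<forall>B'\<in>fin_unions \<A>. B \<subseteq> B' \<longrightarrow> Q B B' \<in> borel \<rightarrow>\<^sub>M prob_algebra borel"
    using Q unfolding transition_system_def by (elim conjE)
  then show ?thesis using B by blast
qed

lemma transition_refl:
  assumes Q: "transition_system \<A> Q" and B: "B \<in> fin_unions \<A>" "B \<noteq> {}"
  shows "Q B B x = return borel x"
proof -
  have "\<forall>B\<in>fin_unions \<A> - {{}}. \<forall>x. Q B B x = return borel x"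
    using Q unfolding transition_system_def by (elim conjE)
  then show ?thesis using B by blast
qed

lemma chapman_kolmogorov:
  assumes Q: "transition_system \<A> Q"
    and B: "B \<in> fin_unions \<A>" "B \<noteq> {}" "B' \<in> fin_unions \<A>" "B'' \<in> fin_unions \<A>" "B \<subseteq> B'" "B' \<subseteq> B''"
    and \<Gamma>: "\<Gamma> \<in> sets borel"
  shows "emeasure (Q B B'' x) \<Gamma> = (\<integral>\<^sup>+ y. emeasure (Q B' B'' y) \<Gamma> \<partial>Q B B' x)"
proof -
  have "\<forall>B\<in>fin_unions \<A> - {{}}. \<forall>B'\<in>fin_unions \<A>. \<forall>B''\<in>fin_unions \<A>. B \<subseteq> B' \<and> B' \<subseteq> B'' \<longrightarrow>
      (\<forall>x. \<forall>\<Gamma>\<in>sets borel.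
        emeasure (Q B B'' x) \<Gamma> = (\<integral>\<^sup>+ y. emeasure (Q B' B'' y) \<Gamma> \<partial>Q B B' x))"
    using Q unfolding transition_system_def by (elim conjE)
  then show ?thesis using B \<Gamma> by blast
qed

lemma prob_kernelD:
  assumes "K \<in> N \<rightarrow>\<^sub>M prob_algebra R" "x \<in> space N"
  shows "prob_space (K x)" "sets (K x) = sets R"
  using measurable_space[OF assms] by (auto simp: space_prob_algebra)

lemma integral_bmfun:
  assumes "prob_space M" and "sets M = sets borel"
  shows "integrable M (apply_bmfun h)" "\<bar>\<integral>y. apply_bmfun h y \<partial>M\<bar> \<le> norm h"
proof -
  interpret prob_space M by fact
  have "apply_bmfun h \<in> borel_measurable M"
    using assms by (simp cong: measurable_cong_sets)
  then show int: "integrable M (apply_bmfun h)"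
    by (intro integrable_const_bound[where B = "norm h"]) (auto simp: abs_le_norm_bmfun)
  have "\<bar>\<integral>y. apply_bmfun h y \<partial>M\<bar> \<le> (\<integral>y. \<bar>apply_bmfun h y\<bar> \<partial>M)"
    by (rule integral_abs_bound)
  also have "\<dots> \<le> (\<integral>y. norm h \<partial>M)"
    using int by (intro integral_mono) (auto simp: abs_le_norm_bmfun)
  finally show "\<bar>\<integral>y. apply_bmfun h y \<partial>M\<bar> \<le> norm h"
    by (simp add: prob_space)
qed

lemma chapman_kolmogorov_integral:
  assumes Q: "transition_system \<A> Q"
    and B: "B \<in> fin_unions \<A>" "B \<noteq> {}" "B' \<in> fin_unions \<A>" "B'' \<in> fin_unions \<A>" "B \<subseteq> B'" "B' \<subseteq> B''"
  shows "(\<integral>z. apply_bmfun h z \<partial>Q B B'' x) = (\<integral>y. (\<integral>z. apply_bmfun h z \<partial>Q B' B'' y) \<partial>Q B B' x)"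
proof -
  have "B' \<noteq> {}" using B by auto
  note K1 = transition_kernel[OF Q B(1,2,3,5)]
    and K2 = transition_kernel[OF Q B(3) \<open>B' \<noteq> {}\<close> B(4,6)]
  have "B \<subseteq> B''" using B by auto
  note K3 = transition_kernel[OF Q B(1,2,4) \<open>B \<subseteq> B''\<close>]
  have sets: "sets (Q B B' x) = sets borel"
    using prob_kernelD(2)[OF K1] by simp
  have K2': "Q B' B'' \<in> Q B B' x \<rightarrow>\<^sub>M subprob_algebra borel"
    using measurable_prob_algebraD[OF K2] by (simp add: measurable_cong_sets[OF sets refl])
  have ne: "space (Q B B' x) \<noteq> {}"
    using sets_eq_imp_space_eq[OF sets] by simp
  have "Q B B'' x = Q B B' x \<bind> Q B' B''"
  proof (rule measure_eqI)
    show "sets (Q B B'' x) = sets (Q B B' x \<bind> Q B' B'')"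
      using sets_bind[OF _ ne, of "Q B' B''" borel] prob_kernelD(2)[OF K2] prob_kernelD(2)[OF K3] by simp
    fix \<Gamma> assume "\<Gamma> \<in> sets (Q B B'' x)"
    then have "\<Gamma> \<in> sets borel" using prob_kernelD(2)[OF K3] by simp
    then show "emeasure (Q B B'' x) \<Gamma> = emeasure (Q B B' x \<bind> Q B' B'') \<Gamma>"
      by (simp add: emeasure_bind[OF ne K2'] chapman_kolmogorov[OF Q B])
  qed
  moreover have "(\<integral>z. apply_bmfun h z \<partial>(Q B B' x \<bind> Q B' B'')) =
      (\<integral>y. (\<integral>z. apply_bmfun h z \<partial>Q B' B'' y) \<partial>Q B B' x)"
  proof (rule integral_bind[where B = "norm h" and B' = 1])
    show "finite_measure (Q B B' x)"
      using prob_kernelD(1)[OF K1, of x] by (simp add: prob_space.finite_measure)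
    show "AE y in Q B B' x. emeasure (Q B' B'' y) (space (Q B' B'' y)) \<le> ennreal 1"
      using prob_kernelD(1)[OF K2] by (simp add: prob_space.emeasure_space_1)
  qed (use K2' in \<open>simp_all add: abs_le_norm_bmfun\<close>)
  ultimately show ?thesis by simp
qed

lemma trans_op_contraction_evolution:
  assumes Q: "transition_system \<A> Q"
    and flow: "flow_on (fin_unions \<A>) 0 (fst F) (snd F)" "snd F 0 \<noteq> {}"
    and gen: "has_generator \<S> Q D" "F \<in> \<S>"
  shows "contraction_evolution (fst F) (trans_op Q F) D"
proof -
  have mono: "snd F s \<subseteq> snd F t" if "0 \<le> s" "s \<le> t" "t \<le> fst F" for s t
    using flow(1) that by (auto simp: flow_on_def mono_on_def)
  have val: "snd F s \<in> fin_unions \<A>" "snd F s \<noteq> {}" if "0 \<le> s" "s \<le> fst F" for s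
    using flow that mono[of 0 s] by (auto simp: flow_on_def)
  have K: "Q (snd F s) (snd F t) \<in> borel \<rightarrow>\<^sub>M prob_algebra borel" if "0 \<le> s" "s \<le> t" "t \<le> fst F" for s t
    using that by (intro transition_kernel[OF Q] val mono) auto
  note prob = prob_kernelD(1)[OF K] and sets = prob_kernelD(2)[OF K]
  have app: "apply_bmfun (trans_op Q F s t h) x = (\<integral>y. apply_bmfun h y \<partial>Q (snd F s) (snd F t) x)"
    if "0 \<le> s" "s \<le> t" "t \<le> fst F" for s t h x
    using apply_trans_op[of Q F s t] K[OF that] by simp
  have D: "closure D = UNIV"
    and D_inv: "\<And>h s t. h \<in> D \<Longrightarrow> 0 \<le> s \<Longrightarrow> s \<le> t \<Longrightarrow> t \<le> fst F \<Longrightarrow> trans_op Q F s t h \<in> D"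
    and C1: "\<And>h t. h \<in> D \<Longrightarrow> t \<in> {0..fst F} \<Longrightarrow>
      continuously_differentiable_on {0..t} (\<lambda>s. trans_op Q F s t h)"
      "\<And>h s. h \<in> D \<Longrightarrow> s \<in> {0..fst F} \<Longrightarrow>
      continuously_differentiable_on {s..fst F} (\<lambda>t. trans_op Q F s t h)"
    and agree: "\<And>h s. h \<in> D \<Longrightarrow> s \<in> {0<..<fst F} \<Longrightarrow>
      - backward_derivative Q F s h = forward_derivative Q F s h"
    using gen unfolding has_generator_def by blast+
  show ?thesis
  proof (rule contraction_evolution.intro)
    fix s t :: real
    assume st: "0 \<le> s" "s \<le> t" "t \<le> fst F"
    show "linear (trans_op Q F s t)"
    proof (rule linearI)
      have int: "integrable (Q (snd F s) (snd F t) x) (apply_bmfun h)" for h x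
        by (intro integral_bmfun prob[OF st] sets[OF st]) auto
      fix h k
      show "trans_op Q F s t (h + k) = trans_op Q F s t h + trans_op Q F s t k"
        by (intro bmfun_eqI) (simp add: app st plus_bmfun.rep_eq int)
      fix c
      show "trans_op Q F s t (c *\<^sub>R h) = c *\<^sub>R trans_op Q F s t h"
        by (intro bmfun_eqI) (simp add: app st scaleR_bmfun.rep_eq)
    qed
    fix h
    show "norm (trans_op Q F s t h) \<le> norm h"
    proof (rule norm_bmfun_le)
      fix x
      show "\<bar>apply_bmfun (trans_op Q F s t h) x\<bar> \<le> norm h"
        using integral_bmfun(2)[OF prob[OF st] sets[OF st]] by (simp add: app st)
    qed
  next
    fix s h assume s: "0 \<le> s" "s \<le> fst F"
    then have "Q (snd F s) (snd F s) x = return borel x" for x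
      using val by (intro transition_refl[OF Q]) auto
    then show "trans_op Q F s s h = h"
      using s by (intro bmfun_eqI) (simp add: app integral_return)
  next
    fix r s t h assume rst: "0 \<le> r" "r \<le> s" "s \<le> t" "t \<le> fst F"
    show "trans_op Q F r s (trans_op Q F s t h) = trans_op Q F r t h"
      using rst chapman_kolmogorov_integral[OF Q, of "snd F r" "snd F s" "snd F t"]
      by (intro bmfun_eqI) (simp add: app val mono)
  next
    fix h s t assume "h \<in> D" "0 \<le> s" "s \<le> t" "t \<le> fst F"
    then show "trans_op Q F s t h \<in> D" by (rule D_inv)
  next
    fix h t assume "h \<in> D" "0 \<le> t" "t \<le> fst F"
    then show "continuously_differentiable_on {0..t} (\<lambda>s. trans_op Q F s t h)"
      and "continuously_differentiable_on {t..fst F} (\<lambda>s. trans_op Q F t s h)"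
      by (simp_all add: C1)
  next
    fix h s assume "h \<in> D" "0 < s" "s < fst F"
    then show "- vector_derivative (\<lambda>r. trans_op Q F r s h) (at_left s) =
        vector_derivative (\<lambda>t. trans_op Q F s t h) (at_right s)"
      using agree[of h s] by (simp add: backward_derivative_def forward_derivative_def)
  qed (rule D)
qed

text \<open>Equality of the partial functions \<open>generator\<close> already forces \<open>D' = D\<close>, so the two
  evolution families satisfy the equations on the same domain. The kernels are then compared on
  indicator functions.\<close>

lemma transition_kernels_eq:
  assumes Q: "transition_system \<A> Q" "transition_system \<A> Q'"
    and flow: "flow_on (fin_unions \<A>) 0 (fst F) (snd F)" "snd F 0 \<noteq> {}" "F \<in> \<S>"
    and has_gen: "has_generator \<S> Q D" "has_generator \<S> Q' D'"
    and gen_eq: "\<forall>s\<in>{0..fst F}. generator Q D F s = generator Q' D' F s"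
    and st: "0 \<le> s" "s \<le> t" "t \<le> fst F"
  shows "Q (snd F s) (snd F t) x = Q' (snd F s) (snd F t) x"
proof -
  have "dom (generator P E F s) = E" for P E
    by (auto simp: generator_def split: if_splits)
  then have "D' = D"
    using gen_eq st by (metis atLeastAtMost_iff order_trans)
  have E: "contraction_evolution (fst F) (trans_op Q F) D"
    by (rule trans_op_contraction_evolution) fact+
  have E': "contraction_evolution (fst F) (trans_op Q' F) D"
    using trans_op_contraction_evolution[OF Q(2) flow(1,2) has_gen(2) flow(3)] \<open>D' = D\<close> by simp
  have "trans_op Q F s t = trans_op Q' F s t"
  proof (rule evolution_determined_by_generator[OF E E' _ st])
    fix r h assume r: "0 < r" "r < fst F" and h: "h \<in> D"
    then have "generator Q D F r h = generator Q' D F r h"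
      using gen_eq \<open>D' = D\<close> by simp
    then show "contraction_evolution.gen (trans_op Q F) r h = contraction_evolution.gen (trans_op Q' F) r h"
      using r h contraction_evolution.gen_def[OF E] contraction_evolution.gen_def[OF E']
      by (simp add: generator_def forward_derivative_def)
  qed
  have mono: "snd F s \<subseteq> snd F t" "snd F 0 \<subseteq> snd F s"
    using flow(1) st by (auto simp: flow_on_def mono_on_def)
  have val: "snd F s \<in> fin_unions \<A>" "snd F s \<noteq> {}" "snd F t \<in> fin_unions \<A>"
    using flow(1,2) st mono by (auto simp: flow_on_def)
  note K = transition_kernel[OF Q(1) val mono(1)] and K' = transition_kernel[OF Q(2) val mono(1)]
  show ?thesis
  proof (rule measure_eqI)
    show "sets (Q (snd F s) (snd F t) x) = sets (Q' (snd F s) (snd F t) x)"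
      using prob_kernelD(2)[OF K] prob_kernelD(2)[OF K'] by simp
    fix \<Gamma> assume "\<Gamma> \<in> sets (Q (snd F s) (snd F t) x)"
    then have \<Gamma>: "\<Gamma> \<in> sets borel" using prob_kernelD(2)[OF K] by simp
    define h where "h = Bmfun (indicator \<Gamma>)"
    have h: "apply_bmfun h = indicator \<Gamma>"
      unfolding h_def using \<Gamma>
      by (intro Bmfun_inverse) (auto simp: bounded_iff indicator_def intro!: exI[of _ 1])
    have "measure (Q (snd F s) (snd F t) x) \<Gamma> = measure (Q' (snd F s) (snd F t) x) \<Gamma>"
      using apply_trans_op[of Q F s t h x, OF K] apply_trans_op[of Q' F s t h x, OF K'] \<Gamma>
        \<open>trans_op Q F s t = trans_op Q' F s t\<close> prob_kernelD(2)[OF K] prob_kernelD(2)[OF K']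
      by (simp add: h)
    then show "emeasure (Q (snd F s) (snd F t) x) \<Gamma> = emeasure (Q' (snd F s) (snd F t) x) \<Gamma>"
      using prob_kernelD(1)[OF K, of x] prob_kernelD(1)[OF K', of x]
      by (simp add: finite_measure.emeasure_eq_measure prob_space.finite_measure)
  qed
qed

section \<open>Consistent orderings of finite sub-semilattices\<close>

lemma indexing_collectionD:
  assumes "indexing_collection (\<A> :: 't::t2_space set set)"
  shows "compact (UNIV :: 't set)"
    and "A \<in> \<A> \<Longrightarrow> closed A"
    and "UNIV \<in> \<A>"
    and "\<B> \<subseteq> \<A> \<Longrightarrow> \<B> \<noteq> {} \<Longrightarrow> \<Inter>\<B> \<in> \<A>"
    and "A \<in> \<A> \<Longrightarrow> B \<in> \<A> \<Longrightarrow> A \<noteq> {} \<Longrightarrow> B \<noteq> {} \<Longrightarrow> A \<inter> B \<noteq> {}"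
  using assms by (simp_all add: indexing_collection_def)

lemma Inter_finite_mem:
  assumes \<A>: "indexing_collection \<A>" and \<J>: "finite \<J>" "\<J> \<noteq> {}" "\<J> \<subseteq> \<A> - {{}}"
  shows "\<Inter>\<J> \<in> \<A> - {{}}"
  using \<J>
proof (induction \<J> rule: finite_ne_induct)
  case (insert A \<J>)
  then have A: "A \<in> \<A>" "A \<noteq> {}" and J: "\<Inter>\<J> \<in> \<A>" "\<Inter>\<J> \<noteq> {}"
    by simp_all
  have "A \<inter> \<Inter>\<J> \<in> \<A>"
    using indexing_collectionD(4)[OF \<A>, of "{A, \<Inter>\<J>}"] A J by simp
  moreover have "A \<inter> \<Inter>\<J> \<noteq> {}"
    by (rule indexing_collectionD(5)[OF \<A>]) fact+
  ultimately show ?case by simp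
qed simp

text \<open>Non-emptiness follows from compactness by the finite intersection property: pairwise non-disjointness, together with
  closure under intersections, makes all finite intersections non-empty.\<close>

lemma least_set_mem:
  assumes "indexing_collection \<A>"
  shows "least_set \<A> \<in> \<A>" "least_set \<A> \<noteq> {}"
proof -
  note comp = indexing_collectionD(1)[OF assms] and closed = indexing_collectionD(2)[OF assms]
    and univ = indexing_collectionD(3)[OF assms] and Int = indexing_collectionD(4)[OF assms]
  show "least_set \<A> \<in> \<A>"
    unfolding least_set_def using univ by (intro Int) auto
  have "UNIV \<inter> \<Inter>(\<A> - {{}}) \<noteq> {}"
  proof (rule compact_imp_fip[OF comp])
    fix \<F> assume \<F>: "finite \<F>" "\<F> \<subseteq> \<A> - {{}}"
    show "UNIV \<inter> \<Inter>\<F> \<noteq> {}"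
      using Inter_finite_mem[OF assms \<F>(1) _ \<F>(2)] by (cases "\<F> = {}") auto
  qed (use closed in auto)
  then show "least_set \<A> \<noteq> {}"
    by (simp add: least_set_def)
qed

lemma least_set_subset: "A \<in> \<A> \<Longrightarrow> A \<noteq> {} \<Longrightarrow> least_set \<A> \<subseteq> A"
  unfolding least_set_def by blast

text \<open>Intersections of subfamilies of \<open>I - {{}}\<close> do the job; the whole space is added so that the
  semilattice is non-empty even if \<open>I - {{}}\<close> is empty.\<close>

lemma finite_subsemilattice_superset:
  assumes \<A>: "indexing_collection \<A>" and I: "finite I" "I \<subseteq> \<A>"
  obtains \<A>' where "finite_subsemilattice \<A> \<A>'" "I - {{}} \<subseteq> \<A>'"
proof
  define I' where "I' = insert UNIV (I - {{}})"
  define \<A>' where "\<A>' = Inter ` {\<J>. \<J> \<subseteq> I' \<and> \<J> \<noteq> {}}"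
  have I': "finite I'" "I' \<subseteq> \<A> - {{}}"
    using indexing_collectionD(3)[OF \<A>] I unfolding I'_def by auto
  have mem: "\<A>' \<subseteq> \<A> - {{}}"
  proof
    fix A assume "A \<in> \<A>'"
    then obtain \<J> where "A = \<Inter>\<J>" "\<J> \<subseteq> I'" "\<J> \<noteq> {}" by (auto simp: \<A>'_def)
    then show "A \<in> \<A> - {{}}"
      using Inter_finite_mem[OF \<A>, of \<J>] I' finite_subset by auto
  qed
  have "A \<inter> B \<in> \<A>'" if A: "A \<in> \<A>'" and B: "B \<in> \<A>'" for A B
  proof -
    obtain \<J> \<K> where "A = \<Inter>\<J>" "\<J> \<subseteq> I'" "\<J> \<noteq> {}" "B = \<Inter>\<K>" "\<K> \<subseteq> I'" "\<K> \<noteq> {}"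
      using A B by (auto simp: \<A>'_def)
    then show ?thesis
      unfolding \<A>'_def by (intro image_eqI[where x = "\<J> \<union> \<K>"]) auto
  qed
  moreover have "finite \<A>'"
    unfolding \<A>'_def using I' by simp
  moreover have "\<A>' \<noteq> {}"
    unfolding \<A>'_def I'_def by blast
  ultimately show "finite_subsemilattice \<A> \<A>'"
    using mem unfolding finite_subsemilattice_def by blast
  show "I - {{}} \<subseteq> \<A>'"
  proof
    fix A assume "A \<in> I - {{}}"
    then show "A \<in> \<A>'"
      unfolding \<A>'_def I'_def by (intro image_eqI[where x = "{A}"]) auto
  qed
qed

text \<open>Sorting by the number of members contained in a set puts every set behind its proper subsets.\<close>

lemma consistent_ordering_exists:
  assumes "finite_subsemilattice \<A> \<A>'"
  obtains ord where "consistent_ordering \<A> \<A>' ord"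
proof -
  have fin: "finite \<A>'" and ne: "\<A>' \<noteq> {}" and Int: "\<And>A B. A \<in> \<A>' \<Longrightarrow> B \<in> \<A>' \<Longrightarrow> A \<inter> B \<in> \<A>'"
    using assms by (auto simp: finite_subsemilattice_def)
  define key where "key A = card {B \<in> \<A>'. B \<subseteq> A}" for A
  obtain xs where xs: "set xs = \<A>'" "distinct xs"
    using finite_distinct_list[OF fin] by blast
  define ys where "ys = sort_key key xs"
  have ys: "set ys = \<A>'" "distinct ys" "sorted (map key ys)"
    using xs by (simp_all add: ys_def)
  have before: "i < j" if "i < length ys" "j < length ys" "ys ! i \<subset> ys ! j" for i j
  proof -
    have "key (ys ! i) < key (ys ! j)"
      unfolding key_def
    proof (rule psubset_card_mono)
      have "ys ! j \<in> \<A>'" using that ys(1) by auto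
      then show "{B \<in> \<A>'. B \<subseteq> ys ! i} \<subset> {B \<in> \<A>'. B \<subseteq> ys ! j}"
        using that(3) by auto
    qed (use fin in simp)
    then show ?thesis
      using sorted_nth_mono[OF ys(3), of j i] that by (cases "j \<le> i") auto
  qed
  have "\<Inter>\<A>' \<in> \<A>'"
    using fin ne Int by (rule finite_Inf_in[where A = \<A>'])
  then obtain k where k: "k < length ys" "ys ! k = \<Inter>\<A>'"
    using ys(1) by (metis in_set_conv_nth)
  have len: "0 < length ys" using k(1) by linarith
  then have "\<not> ys ! k \<subset> ys ! 0"
    using before[of k 0] k(1) by blast
  moreover have "ys ! 0 \<in> \<A>'"
    using nth_mem[OF len] ys(1) by simp
  then have "\<Inter>\<A>' \<subseteq> ys ! 0"
    by (rule Inter_lower)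
  ultimately have least: "ys ! 0 = \<Inter>\<A>'"
    unfolding k(2) psubset_eq by simp
  have "consistent_ordering \<A> \<A>' (least_set \<A> # ys)"
    unfolding consistent_ordering_def
  proof (intro conjI allI impI ballI)
    fix i A assume i: "Suc i < length (least_set \<A> # ys)" and A: "A \<in> \<A>'"
      and less: "A \<subset> (least_set \<A> # ys) ! Suc i"
    obtain j where j: "j < length ys" "A = ys ! j"
      using A ys(1) by (metis in_set_conv_nth)
    then have "j < i"
      using before[of j i] i less by simp
    then show "\<exists>j\<in>{1..i}. A = (least_set \<A> # ys) ! j"
      using j by (intro bexI[of _ "Suc j"]) auto
  qed (use assms ys least in auto)
  then show ?thesis ..
qed

text \<open>The use of consistency: the intersection of a set with an earlier one is again in \<open>\<A>'\<close>, and it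
  is a proper subset because a set contained in an earlier one would itself have come before it.
  The first entry \<open>least_set \<A>\<close>, which need not belong to \<open>\<A>'\<close>, lies below everything.\<close>

lemma consistent_ordering_Int:
  assumes ord: "consistent_ordering \<A> \<A>' ord" and ij: "j < i" "i < length ord"
  shows "ord ! i \<inter> ord ! j \<in> set (take i ord)"
proof -
  have \<A>': "finite_subsemilattice \<A> \<A>'" and dist: "distinct (tl ord)" and set: "set (tl ord) = \<A>'"
    and zero: "ord ! 0 = least_set \<A>"
    and before: "\<And>i A. Suc i < length ord \<Longrightarrow> A \<in> \<A>' \<Longrightarrow> A \<subset> ord ! Suc i \<Longrightarrow> \<exists>j\<in>{1..i}. A = ord ! j"
    using ord unfolding consistent_ordering_def by blast+
  have mem: "ord ! k \<in> \<A>'" if "0 < k" "k < length ord" for k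
    using that nth_mem[of "k - 1" "tl ord"] set by (simp add: nth_tl)
  have inj: "k = l" if "0 < k" "k < length ord" "0 < l" "l < length ord" "ord ! k = ord ! l" for k l
  proof -
    have "k - 1 < length (tl ord)" "l - 1 < length (tl ord)" "tl ord ! (k - 1) = tl ord ! (l - 1)"
      using that by (simp_all add: nth_tl diff_less_mono)
    then have "k - 1 = l - 1"
      using nth_eq_iff_index_eq[OF dist] by blast
    then show ?thesis using that by linarith
  qed
  have in_take: "ord ! k \<in> set (take i ord)" if "k < i" for k
    using that ij by (auto simp: in_set_conv_nth intro!: exI[of _ k])
  show ?thesis
  proof (cases "j = 0")
    case True
    have "ord ! 0 \<subseteq> ord ! i"
      unfolding zero
    proof (rule least_set_subset)
      show "ord ! i \<in> \<A>" "ord ! i \<noteq> {}"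
        using mem[of i] ij \<A>' unfolding finite_subsemilattice_def by auto
    qed
    then have "ord ! i \<inter> ord ! j = ord ! 0" using True by auto
    then show ?thesis using in_take[of 0] ij True by simp
  next
    case False
    have "ord ! i \<inter> ord ! j \<in> \<A>'"
      using mem[of i] mem[of j] ij False \<A>' unfolding finite_subsemilattice_def by auto
    moreover have "\<not> ord ! i \<subseteq> ord ! j"
    proof
      assume "ord ! i \<subseteq> ord ! j"
      moreover have "ord ! i \<noteq> ord ! j"
        using inj[of i j] ij False by auto
      ultimately have "ord ! i \<subset> ord ! Suc (j - 1)"
        using False by auto
      then have "\<exists>k\<in>{1..j - 1}. ord ! i = ord ! k"
        using mem[of i] ij False by (intro before) auto
      then obtain k where "k \<in> {1..j - 1}" "ord ! i = ord ! k" ..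
      then show False
        using inj[of i k] ij False by force
    qed
    ultimately have "ord ! i \<inter> ord ! j \<in> \<A>'" "ord ! i \<inter> ord ! j \<subset> ord ! Suc (i - 1)"
      using ij by auto
    then have "\<exists>k\<in>{1..i - 1}. ord ! i \<inter> ord ! j = ord ! k"
      using ij by (intro before) auto
    then obtain k where "k \<in> {1..i - 1}" "ord ! i \<inter> ord ! j = ord ! k" ..
    then show ?thesis
      using in_take[of k] ij by auto
  qed
qed

section \<open>Solving inclusion-exclusion along an ordering\<close>

text \<open>The index sets that contain the new position are split off; the one consisting of it alone gives
  \<open>X A\<close>, and in each other one the new set cuts the remaining intersection at the cost of a sign.\<close>

lemma incl_excl_snoc:
  "incl_excl X (As @ [A]) \<omega> = incl_excl X As \<omega> + X A \<omega> - incl_excl X (map ((\<inter>) A) As) \<omega>"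
proof -
  let ?n = "length As"
  define S where "S = {J. J \<subseteq> {..<?n} \<and> J \<noteq> {}}"
  define w where "w J = (- 1) ^ (card J + 1) * X (\<Inter>j\<in>J. (As @ [A]) ! j) \<omega>" for J
  have fin: "finite S" unfolding S_def by (rule finite_subset[of _ "Pow {..<?n}"]) auto
  have finJ: "finite J" "?n \<notin> J" "J \<noteq> {}" "J \<subseteq> {..<?n}" if "J \<in> S" for J
    using that finite_subset unfolding S_def by auto
  have split: "{J. J \<subseteq> {..<length (As @ [A])} \<and> J \<noteq> {}} = S \<union> (insert ?n ` S \<union> {{?n}})" (is "?L = ?R")
  proof
    show "?L \<subseteq> ?R"
    proof
      fix J assume J: "J \<in> ?L"
      show "J \<in> ?R"
      proof (cases "?n \<in> J")
        case False
        have "J \<subseteq> {..<?n}"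
        proof
          fix x assume "x \<in> J"
          then have "x < Suc ?n" "x \<noteq> ?n" using J False by auto
          then show "x \<in> {..<?n}" by simp
        qed
        then show ?thesis using J by (simp add: S_def)
      next
        case True
        have "J - {?n} \<subseteq> {..<?n}"
        proof
          fix x assume "x \<in> J - {?n}"
          then have "x < Suc ?n" "x \<noteq> ?n" using J by auto
          then show "x \<in> {..<?n}" by simp
        qed
        then have "J - {?n} \<noteq> {} \<Longrightarrow> J - {?n} \<in> S"
          by (simp add: S_def)
        moreover have "insert ?n (J - {?n}) = J" using True by (rule insert_Diff)
        ultimately show ?thesis
          using True by (metis UnI2 UnCI image_eqI insert_Diff insertI1)
      qed
    qed
    show "?R \<subseteq> ?L" by (auto simp: S_def)
  qed
  have inj: "inj_on (insert ?n) S"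
    using finJ(2) by (intro inj_onI) (metis insert_ident)
  have nth_append_Inter: "(\<Inter>j\<in>J. (As @ [A]) ! j) = (\<Inter>j\<in>J. As ! j)" if "J \<in> S" for J
  proof (rule INF_cong[OF refl])
    fix j assume "j \<in> J"
    then have "j < ?n" using finJ(4)[OF that] by blast
    then show "(As @ [A]) ! j = As ! j" by (simp add: nth_append)
  qed
  have nth_map_Inter: "(\<Inter>j\<in>J. map ((\<inter>) A) As ! j) = A \<inter> (\<Inter>j\<in>J. As ! j)" if "J \<in> S" for J
  proof -
    have "(\<Inter>j\<in>J. map ((\<inter>) A) As ! j) = (\<Inter>j\<in>J. A \<inter> As ! j)"
    proof (rule INF_cong[OF refl])
      fix j assume "j \<in> J"
      then have "j < ?n" using finJ(4)[OF that] by blast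
      then show "map ((\<inter>) A) As ! j = A \<inter> As ! j" by simp
    qed
    then show ?thesis
      using finJ(3)[OF that] by (simp add: INF_inf_const1)
  qed
  have "incl_excl X (As @ [A]) \<omega> = (\<Sum>J\<in>S. w J) + ((\<Sum>J\<in>insert ?n ` S. w J) + w {?n})"
  proof -
    have "S \<inter> (insert ?n ` S \<union> {{?n}}) = {}" "insert ?n ` S \<inter> {{?n}} = {}"
      using finJ(2,3) by blast+
    then show ?thesis
      unfolding incl_excl_def split w_def[symmetric] using fin
      by (simp only: sum.union_disjoint finite_Un finite_imageI finite.intros simp_thms) simp
  qed
  also have "(\<Sum>J\<in>S. w J) = incl_excl X As \<omega>"
    unfolding incl_excl_def S_def[symmetric]
  proof (rule sum.cong[OF refl])
    fix J assume "J \<in> S"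
    then show "w J = (- 1) ^ (card J + 1) * X (\<Inter>j\<in>J. As ! j) \<omega>"
      by (simp add: w_def nth_append_Inter)
  qed
  also have "w {?n} = X A \<omega>" by (simp add: w_def)
  also have "(\<Sum>J\<in>insert ?n ` S. w J) = (\<Sum>J\<in>S. w (insert ?n J))"
    by (simp add: sum.reindex[OF inj])
  also have "\<dots> = - incl_excl X (map ((\<inter>) A) As) \<omega>"
    unfolding incl_excl_def length_map S_def[symmetric] sum_negf[symmetric]
  proof (rule sum.cong[OF refl])
    fix J assume J: "J \<in> S"
    have "(\<Inter>j\<in>insert ?n J. (As @ [A]) ! j) = (\<Inter>j\<in>J. map ((\<inter>) A) As ! j)"
      by (simp add: nth_append_Inter[OF J] nth_map_Inter[OF J])
    then show "w (insert ?n J) = - ((- 1) ^ (card J + 1) * X (\<Inter>j\<in>J. map ((\<inter>) A) As ! j) \<omega>)"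
      using finJ(1,2)[OF J] unfolding w_def by simp
  qed
  finally show ?thesis by simp
qed

text \<open>A functional \<open>f\<close> of set functions is a linear combination of the inclusion-exclusion sums over the
  initial segments of \<open>As\<close>. The coefficients are chosen before the set function, hence serve all
  outcomes of all processes at once. As \<^const>\<open>incl_excl\<close> expects an
  outcome, a set function is passed as a process on the one-point space.\<close>

definition lin_comb :: "'t set list \<Rightarrow> (('t set \<Rightarrow> real) \<Rightarrow> real) \<Rightarrow> bool" where
  "lin_comb As f \<longleftrightarrow> (\<exists>c. \<forall>Z. f Z =
    (\<Sum>k<length As. c k * incl_excl (\<lambda>A (_ :: unit). Z A) (take (Suc k) As) ()))"

lemma lin_comb_incl_excl:
  assumes "k < length As"
  shows "lin_comb As (\<lambda>Z. incl_excl (\<lambda>A _. Z A) (take (Suc k) As) ())"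
  unfolding lin_comb_def using assms
  by (intro exI[of _ "\<lambda>l. if l = k then 1 else 0"]) (simp add: mult_delta_left)

lemma lin_comb_scale:
  assumes "lin_comb As f" shows "lin_comb As (\<lambda>Z. r * f Z)"
proof -
  obtain c where "\<And>Z. f Z = (\<Sum>k<length As. c k * incl_excl (\<lambda>A (_ :: unit). Z A) (take (Suc k) As) ())"
    using assms unfolding lin_comb_def by blast
  then show ?thesis
    unfolding lin_comb_def
    by (intro exI[of _ "\<lambda>k. r * c k"]) (simp add: sum_distrib_left mult.assoc)
qed

lemma lin_comb_add:
  assumes "lin_comb As f" "lin_comb As g" shows "lin_comb As (\<lambda>Z. f Z + g Z)"
proof -
  obtain c d where "\<And>Z. f Z = (\<Sum>k<length As. c k * incl_excl (\<lambda>A (_ :: unit). Z A) (take (Suc k) As) ())"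
    "\<And>Z. g Z = (\<Sum>k<length As. d k * incl_excl (\<lambda>A (_ :: unit). Z A) (take (Suc k) As) ())"
    using assms unfolding lin_comb_def by blast
  then show ?thesis
    unfolding lin_comb_def
    by (intro exI[of _ "\<lambda>k. c k + d k"]) (simp add: sum.distrib distrib_right)
qed

lemma lin_comb_sum:
  assumes "\<And>J. J \<in> S \<Longrightarrow> lin_comb As (f J)" shows "lin_comb As (\<lambda>Z. \<Sum>J\<in>S. f J Z)"
  using assms
proof (induction S rule: infinite_finite_induct)
  case (insert J S)
  then show ?case by (simp add: lin_comb_add)
qed (auto simp: lin_comb_def intro!: exI[of _ "\<lambda>_. 0"])

text \<open>By \<open>incl_excl_snoc\<close>, the value on \<open>A = As ! i\<close> is the sum over \<open>As\<^sub>0, \<dots>, As\<^sub>i\<close> minus the sum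
  over \<open>As\<^sub>0, \<dots>, As\<^sub>i\<^sub>-\<^sub>1\<close> plus the sum over \<open>A \<inter> As\<^sub>0, \<dots>, A \<inter> As\<^sub>i\<^sub>-\<^sub>1\<close>. All intersections
  formed in the last sum are earlier entries of the list, so induction on \<open>i\<close> applies to them.\<close>

lemma lin_comb_nth:
  assumes Int: "\<And>i j. j < i \<Longrightarrow> i < length As \<Longrightarrow> As ! i \<inter> As ! j \<in> set (take i As)"
    and i: "i < length As"
  shows "lin_comb As (\<lambda>Z. Z (As ! i))"
  using i
proof (induction i rule: less_induct)
  case (less i)
  define Bs where "Bs = map ((\<inter>) (As ! i)) (take i As)"
  have Int_closed: "A \<inter> B \<in> set (take i As)"
    if A: "A \<in> set (take i As)" and B: "B \<in> set (take i As)" for A B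
  proof -
    obtain k where k: "A = As ! k" "k < i"
      using A less.prems by (auto simp: in_set_conv_nth)
    obtain l where l: "B = As ! l" "l < i"
      using B less.prems by (auto simp: in_set_conv_nth)
    have sub: "set (take m As) \<subseteq> set (take i As)" if "m < i" for m
      using that by (intro set_take_subset_set_take) simp
    consider "k < l" | "k = l" | "l < k" by linarith
    then show ?thesis
    proof cases
      case 1
      then have "B \<inter> A \<in> set (take l As)" using Int[of k l] k l less.prems by simp
      then show ?thesis using sub[OF l(2)] by (auto simp: Int_commute)
    next
      case 2
      then show ?thesis using A k l by simp
    next
      case 3
      then have "A \<inter> B \<in> set (take k As)" using Int[of l k] k l less.prems by simp
      then show ?thesis using sub[OF k(2)] by auto
    qed
  qed
  have Inter_closed: "(\<Inter>j\<in>J. Bs ! j) \<in> set (take i As)" if J: "J \<subseteq> {..<length Bs}" "J \<noteq> {}" for J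
  proof -
    have "finite J" using J(1) finite_subset by blast
    then show ?thesis
      using J(2,1)
    proof (induction J rule: finite_ne_induct)
      case (singleton j)
      then show ?case using less.prems Int[of j i] by (simp add: Bs_def)
    next
      case (insert j J)
      then have "Bs ! j \<in> set (take i As)" using less.prems Int[of j i] by (simp add: Bs_def)
      then show ?case using insert Int_closed by simp
    qed
  qed
  have inter: "lin_comb As (\<lambda>Z. Z (\<Inter>j\<in>J. Bs ! j))"
    if J: "J \<subseteq> {..<length Bs}" "J \<noteq> {}" for J
  proof -
    obtain k where "k < i" "(\<Inter>j\<in>J. Bs ! j) = As ! k"
      using Inter_closed[OF J]
      by (auto simp: in_set_conv_nth)
    then show ?thesis using less.IH[of k] less.prems by simp
  qed
  have "lin_comb As (\<lambda>Z. incl_excl (\<lambda>A _. Z A) Bs ())"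
    unfolding incl_excl_def by (intro lin_comb_sum lin_comb_scale inter) auto
  moreover have "lin_comb As (\<lambda>Z. - 1 * incl_excl (\<lambda>A _. Z A) (take i As) ())"
  proof (cases i)
    case 0
    then show ?thesis
      by (auto simp: lin_comb_def incl_excl_def intro!: exI[of _ "\<lambda>_. 0"])
  next
    case (Suc k)
    then show ?thesis
      using less.prems by (intro lin_comb_scale) (simp add: lin_comb_incl_excl)
  qed
  moreover note lin_comb_incl_excl[OF less.prems]
  ultimately have "lin_comb As (\<lambda>Z. incl_excl (\<lambda>A _. Z A) (take (Suc i) As) () +
      (- 1 * incl_excl (\<lambda>A _. Z A) (take i As) () + incl_excl (\<lambda>A _. Z A) Bs ()))"
    by (intro lin_comb_add)
  then show ?case
    using less.prems by (simp add: take_Suc_conv_app_nth incl_excl_snoc Bs_def)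
qed

section \<open>The Markov chain along an increasing sequence\<close>

lemma ext_u_eq_incl_excl:
  assumes \<A>: "{} \<in> \<A>" and B: "B \<in> fin_unions \<A>"
  obtains As where "As \<noteq> []" "set As \<subseteq> \<A>" "\<Union>(set As) = B" "ext_u \<A> X B = incl_excl X As"
proof -
  obtain \<B> where \<B>: "finite \<B>" "\<B> \<subseteq> \<A>" "B = \<Union>\<B>"
    using B by (auto simp: fin_unions_def)
  then obtain Bs where Bs: "set Bs = \<B>"
    using finite_list by blast
  have "\<exists>Y As. As \<noteq> [] \<and> set As \<subseteq> \<A> \<and> \<Union>(set As) = B \<and> Y = incl_excl X As"
    using \<A> \<B> Bs by (intro exI[of _ "incl_excl X ({} # Bs)"] exI[of _ "{} # Bs"]) auto
  from someI_ex[OF this] show ?thesis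
    using that unfolding ext_u_def by blast
qed

lemma AE_ext_u_eq_incl_excl:
  assumes \<A>: "{} \<in> \<A>" and X: "incl_excl_consistent \<A> M X"
    and As: "As \<noteq> []" "set As \<subseteq> \<A>"
  shows "AE \<omega> in M. ext_u \<A> X (\<Union>(set As)) \<omega> = incl_excl X As \<omega>"
proof -
  have "\<Union>(set As) \<in> fin_unions \<A>"
    using As by (auto simp: fin_unions_def)
  then obtain Bs where "Bs \<noteq> []" "set Bs \<subseteq> \<A>" "\<Union>(set Bs) = \<Union>(set As)"
    "ext_u \<A> X (\<Union>(set As)) = incl_excl X Bs"
    using ext_u_eq_incl_excl[OF \<A>] by blast
  then show ?thesis
    using X As unfolding incl_excl_consistent_def by auto
qed

lemma incl_excl_measurable:
  assumes \<A>: "indexing_collection \<A>" and As: "set As \<subseteq> \<A>"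
    and X: "\<And>A. A \<in> \<A> \<Longrightarrow> A \<subseteq> \<Union>(set As) \<Longrightarrow> X A \<in> borel_measurable N"
  shows "incl_excl X As \<in> borel_measurable N"
proof -
  have "X (\<Inter>j\<in>J. As ! j) \<in> borel_measurable N" if J: "J \<subseteq> {..<length As}" "J \<noteq> {}" for J
  proof (rule X)
    have nth: "As ! j \<in> set As" if "j \<in> J" for j
      using that J by auto
    show "(\<Inter>j\<in>J. As ! j) \<in> \<A>"
      using nth As J by (intro indexing_collectionD(4)[OF \<A>]) auto
    show "(\<Inter>j\<in>J. As ! j) \<subseteq> \<Union>(set As)"
      using nth J by blast
  qed
  then show ?thesis
    unfolding incl_excl_def[abs_def] by (intro borel_measurable_sum borel_measurable_times) auto
qed

lemma space_minimal_filtration [simp]: "space (minimal_filtration \<A> M X B) = space M"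
  unfolding minimal_filtration_def by (simp add: space_measure_of_conv)

lemma sets_minimal_filtration:
  "sets (minimal_filtration \<A> M X B) = sigma_sets (space M)
    ({X A -` \<Gamma> \<inter> space M | A \<Gamma>. A \<in> \<A> \<and> A \<subseteq> B \<and> \<Gamma> \<in> sets borel} \<union> null_sets M)"
  unfolding minimal_filtration_def
  by (rule sets_measure_of) (use sets.sets_into_space in blast)

lemma subalgebra_minimal_filtration:
  assumes "process \<A> M X"
  shows "subalgebra M (minimal_filtration \<A> M X B)"
  unfolding subalgebra_def sets_minimal_filtration
  using assms
  by (auto simp: process_def intro!: sets.sigma_sets_subset measurable_sets)

lemma ext_u_measurable:
  assumes \<A>: "indexing_collection \<A>" and B: "B \<in> fin_unions \<A>" "B \<subseteq> B'"
  shows "ext_u \<A> X B \<in> borel_measurable (minimal_filtration \<A> M X B')"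
proof -
  have "{} \<in> \<A>" using \<A> by (simp add: indexing_collection_def)
  then obtain As where As: "set As \<subseteq> \<A>" "\<Union>(set As) = B" "ext_u \<A> X B = incl_excl X As"
    using ext_u_eq_incl_excl[OF _ B(1)] by metis
  have "X A \<in> borel_measurable (minimal_filtration \<A> M X B')" if "A \<in> \<A>" "A \<subseteq> \<Union>(set As)" for A
  proof (rule measurableI)
    fix \<Gamma> :: "real set" assume "\<Gamma> \<in> sets borel"
    then have "X A -` \<Gamma> \<inter> space M \<in> sets (minimal_filtration \<A> M X B')"
      using that As(2) B(2) unfolding sets_minimal_filtration
      by (intro sigma_sets.Basic) blast
    then show "X A -` \<Gamma> \<inter> space (minimal_filtration \<A> M X B') \<in> sets (minimal_filtration \<A> M X B')"
      by simp
  qed simp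
  then show ?thesis
    unfolding As(3) by (rule incl_excl_measurable[OF \<A> As(1)])
qed

lemma ext_u_borel_measurable:
  assumes "indexing_collection \<A>" "process \<A> M X" "B \<in> fin_unions \<A>"
  shows "ext_u \<A> X B \<in> borel_measurable M"
  using measurable_from_subalg[OF subalgebra_minimal_filtration[OF assms(2)]]
    ext_u_measurable[OF assms(1,3) order_refl] by blast

text \<open>The event that the first \<open>m + 1\<close> coordinates lie in their sides of the rectangle belongs to the
  \<open>\<sigma>\<close>-algebra of \<open>B m\<close>. On it the indicator of the event for the last coordinate may be replaced
  by its conditional expectation, which the Markov property identifies with the kernel.\<close>

lemma markov_step:
  assumes \<A>: "indexing_collection \<A>" and Q: "transition_system \<A> Q" and X: "markov_process \<A> Q M X"
    and B: "\<And>k. k \<le> Suc m \<Longrightarrow> B k \<in> fin_unions \<A>" "B 0 \<noteq> {}"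
      "\<And>k. k \<le> m \<Longrightarrow> B k \<subseteq> B (Suc k)"
    and E: "\<And>k. k \<le> Suc m \<Longrightarrow> E k \<in> sets borel"
  shows "measure (distr M (\<Pi>\<^sub>M k\<in>{..Suc m}. borel) (\<lambda>\<omega>. \<lambda>k\<in>{..Suc m}. ext_u \<A> X (B k) \<omega>)) (Pi\<^sub>E {..Suc m} E) =
    (\<integral>y. indicator (Pi\<^sub>E {..m} E) y * measure (Q (B m) (B (Suc m)) (y m)) (E (Suc m))
      \<partial>distr M (\<Pi>\<^sub>M k\<in>{..m}. borel) (\<lambda>\<omega>. \<lambda>k\<in>{..m}. ext_u \<A> X (B k) \<omega>))"
proof -
  have proc: "process \<A> M X"
    and cond: "\<And>B B' \<Gamma>. B \<in> fin_unions \<A> - {{}} \<Longrightarrow> B' \<in> fin_unions \<A> \<Longrightarrow> B \<subseteq> B' \<Longrightarrow> \<Gamma> \<in> sets borel \<Longrightarrow>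
      AE \<omega> in M. real_cond_exp M (minimal_filtration \<A> M X B)
          (indicator {\<omega>' \<in> space M. ext_u \<A> X B' \<omega>' \<in> \<Gamma>}) \<omega> = measure (Q B B' (ext_u \<A> X B \<omega>)) \<Gamma>"
    using X by (simp_all add: markov_process_def)
  interpret prob_space M using proc by (simp add: process_def)
  define Y where "Y k = ext_u \<A> X (B k)" for k
  let ?F = "minimal_filtration \<A> M X (B m)"
  have sub: "B k \<subseteq> B l" if "k \<le> l" "l \<le> Suc m" for k l
    using that by (induction l rule: dec_induct) (use B(3) in force)+
  have ne: "B m \<noteq> {}" using sub[of 0 m] B(2) by auto
  have Y_F: "Y k \<in> borel_measurable ?F" if "k \<le> m" for k
    unfolding Y_def using that by (intro ext_u_measurable[OF \<A>] B sub) auto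
  interpret F: finite_measure_subalgebra M ?F
    by unfold_locales (rule subalgebra_minimal_filtration[OF proc])
  have Y [measurable]: "Y k \<in> borel_measurable M" if "k \<le> Suc m" for k
    unfolding Y_def by (rule ext_u_borel_measurable[OF \<A> proc B(1)[OF that]])
  have kernel: "Q (B m) (B (Suc m)) \<in> borel \<rightarrow>\<^sub>M prob_algebra borel"
    by (rule transition_kernel[OF Q]) (use B ne in auto)
  have kernel_measurable [measurable]: "(\<lambda>x. measure (Q (B m) (B (Suc m)) x) (E (Suc m))) \<in> borel_measurable borel"
    by (rule measurable_compose[OF kernel measurable_measure_prob_algebra]) (simp add: E)
  have Yvec: "(\<lambda>\<omega>. \<lambda>k\<in>{..l}. Y k \<omega>) \<in> M \<rightarrow>\<^sub>M (\<Pi>\<^sub>M k\<in>{..l}. borel)" if "l \<le> Suc m" for l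
    using that by (intro measurable_restrict Y) auto
  define S where "S = {\<omega> \<in> space M. \<forall>k\<in>{..m}. Y k \<omega> \<in> E k}"
  define R where "R = {\<omega> \<in> space M. Y (Suc m) \<omega> \<in> E (Suc m)}"
  have S: "S \<in> sets ?F"
  proof -
    have "{\<omega> \<in> space ?F. \<forall>k\<in>{..m}. Y k \<omega> \<in> E k} \<in> sets ?F"
      using Y_F E by (intro sets.sets_Collect_finite_All' measurable_sets_Collect[of _ ?F borel]) auto
    then show ?thesis by (simp add: S_def)
  qed
  then have S_M: "S \<in> sets M" using F.subalg by (auto simp: subalgebra_def)
  have R: "R \<in> sets M"
    unfolding R_def using Y[of "Suc m"] E[of "Suc m"] by (intro measurable_sets_Collect[of _ M borel]) auto
  have "measure (distr M (\<Pi>\<^sub>M k\<in>{..Suc m}. borel) (\<lambda>\<omega>. \<lambda>k\<in>{..Suc m}. Y k \<omega>)) (Pi\<^sub>E {..Suc m} E) = measure M (S \<inter> R)"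
    by (subst measure_distr[OF Yvec])
      (auto simp: S_def R_def PiE_iff le_Suc_eq E intro!: sets_PiM_I_finite arg_cong[where f = "measure M"])
  also have "\<dots> = (\<integral>\<omega>\<in>S. indicator R \<omega> \<partial>M)"
    unfolding set_lebesgue_integral_def using S_M R
    by (simp flip: indicator_inter_arith)
  also have "\<dots> = (\<integral>\<omega>\<in>S. real_cond_exp M ?F (indicator R) \<omega> \<partial>M)"
    using S R by (intro F.real_cond_exp_intA) (auto simp: integrable_indicator_iff less_top[symmetric])
  also have "\<dots> = (\<integral>\<omega>. indicator S \<omega> * measure (Q (B m) (B (Suc m)) (Y m \<omega>)) (E (Suc m)) \<partial>M)"
    unfolding set_lebesgue_integral_def
  proof (rule integral_cong_AE)
    have "AE \<omega> in M. real_cond_exp M ?F (indicator R) \<omega> = measure (Q (B m) (B (Suc m)) (Y m \<omega>)) (E (Suc m))"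
      unfolding R_def Y_def using B ne E by (intro cond) auto
    then show "AE \<omega> in M. indicator S \<omega> *\<^sub>R real_cond_exp M ?F (indicator R) \<omega> =
        indicator S \<omega> * measure (Q (B m) (B (Suc m)) (Y m \<omega>)) (E (Suc m))"
      by eventually_elim simp
  qed (use S_M Y[of m] in measurable)
  also have "\<dots> = (\<integral>\<omega>. indicator (Pi\<^sub>E {..m} E) (\<lambda>k\<in>{..m}. Y k \<omega>) *
      measure (Q (B m) (B (Suc m)) ((\<lambda>k\<in>{..m}. Y k \<omega>) m)) (E (Suc m)) \<partial>M)"
    by (intro Bochner_Integration.integral_cong refl) (auto simp: S_def indicator_def PiE_iff)
  also have "\<dots> = (\<integral>y. indicator (Pi\<^sub>E {..m} E) y * measure (Q (B m) (B (Suc m)) (y m)) (E (Suc m))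
      \<partial>distr M (\<Pi>\<^sub>M k\<in>{..m}. borel) (\<lambda>\<omega>. \<lambda>k\<in>{..m}. Y k \<omega>))"
  proof (rule integral_distr[symmetric, OF Yvec])
    have "(\<lambda>y :: nat \<Rightarrow> real. y m) \<in> (\<Pi>\<^sub>M k\<in>{..m}. borel) \<rightarrow>\<^sub>M borel"
      by (rule measurable_component_singleton) simp
    moreover have "Pi\<^sub>E {..m} E \<in> sets (\<Pi>\<^sub>M k\<in>{..m}. borel)"
      using E by (intro sets_PiM_I_finite) auto
    ultimately show "(\<lambda>y. indicator (Pi\<^sub>E {..m} E) y * measure (Q (B m) (B (Suc m)) (y m)) (E (Suc m)))
        \<in> borel_measurable (\<Pi>\<^sub>M k\<in>{..m}. borel)"
      by (intro borel_measurable_times borel_measurable_indicator measurable_compose[OF _ kernel_measurable])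
  qed simp
  finally show ?thesis unfolding Y_def .
qed

text \<open>Rectangles determine a probability measure on a finite product, and \<open>markov_step\<close> computes their
  probabilities from the law of the shorter chain, which is the same for both processes by induction.\<close>

lemma markov_chain_law_eq:
  assumes \<A>: "indexing_collection \<A>"
    and Q: "transition_system \<A> Q" "transition_system \<A> Q'"
    and X: "markov_process \<A> Q M X" and X': "markov_process \<A> Q' M' X'"
    and init: "distr M borel (ext_u \<A> X (B 0)) = distr M' borel (ext_u \<A> X' (B 0))"
    and B: "\<And>k. k \<le> n \<Longrightarrow> B k \<in> fin_unions \<A>" "B 0 \<noteq> {}" "\<And>k. k < n \<Longrightarrow> B k \<subseteq> B (Suc k)"
    and kernel: "\<And>k x. k < n \<Longrightarrow> Q (B k) (B (Suc k)) x = Q' (B k) (B (Suc k)) x"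
  shows "distr M (\<Pi>\<^sub>M k\<in>{..n}. borel) (\<lambda>\<omega>. \<lambda>k\<in>{..n}. ext_u \<A> X (B k) \<omega>) =
    distr M' (\<Pi>\<^sub>M k\<in>{..n}. borel) (\<lambda>\<omega>. \<lambda>k\<in>{..n}. ext_u \<A> X' (B k) \<omega>)"
proof -
  have proc: "process \<A> M X" "process \<A> M' X'"
    using X X' by (simp_all add: markov_process_def)
  interpret M: prob_space M using proc by (simp add: process_def)
  interpret M': prob_space M' using proc by (simp add: process_def)
  have meas: "ext_u \<A> X (B k) \<in> borel_measurable M" "ext_u \<A> X' (B k) \<in> borel_measurable M'" if "k \<le> n" for k
    by (rule ext_u_borel_measurable[OF \<A> proc(1) B(1)[OF that]],
        rule ext_u_borel_measurable[OF \<A> proc(2) B(1)[OF that]])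
  define L where "L m = distr M (\<Pi>\<^sub>M k\<in>{..m}. borel) (\<lambda>\<omega>. \<lambda>k\<in>{..m}. ext_u \<A> X (B k) \<omega>)" for m
  define L' where "L' m = distr M' (\<Pi>\<^sub>M k\<in>{..m}. borel) (\<lambda>\<omega>. \<lambda>k\<in>{..m}. ext_u \<A> X' (B k) \<omega>)" for m
  have prob: "prob_space (L m)" "prob_space (L' m)" if "m \<le> n" for m
    unfolding L_def L'_def using that
    by (auto intro!: M.prob_space_distr M'.prob_space_distr measurable_restrict meas)
  have sets: "sets (L m) = sets (\<Pi>\<^sub>M k\<in>{..m}. borel)" "sets (L' m) = sets (\<Pi>\<^sub>M k\<in>{..m}. borel)" for m
    by (simp_all add: L_def L'_def)
  have "m \<le> n \<Longrightarrow> L m = L' m" for m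
  proof (induction m)
    case 0
    have "(\<lambda>x. \<lambda>k\<in>{..0::nat}. x) \<in> borel \<rightarrow>\<^sub>M (\<Pi>\<^sub>M k\<in>{..0}. borel :: real measure)"
      by (intro measurable_restrict) auto
    note distr_distr[OF this]
    moreover have "(\<lambda>\<omega>. \<lambda>k\<in>{..0}. Z (B k) \<omega>) = (\<lambda>x. \<lambda>k\<in>{..0}. x) \<circ> Z (B 0)" for Z :: "'a set \<Rightarrow> 'z \<Rightarrow> real"
      by (auto simp: fun_eq_iff)
    ultimately show ?case
      unfolding L_def L'_def using meas[of 0] init by (metis le0)
  next
    case (Suc m)
    interpret LS: prob_space "L (Suc m)" by (rule prob) fact
    interpret LS': prob_space "L' (Suc m)" by (rule prob) fact
    show ?case
    proof (rule measure_eqI_PiM_finite[OF _ sets, where A = "\<lambda>_. Pi\<^sub>E {..Suc m} (\<lambda>_. UNIV)"])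
      fix E :: "nat \<Rightarrow> real set" assume E: "\<And>k. k \<in> {..Suc m} \<Longrightarrow> E k \<in> sets borel"
      have "measure (L (Suc m)) (Pi\<^sub>E {..Suc m} E) =
          (\<integral>y. indicator (Pi\<^sub>E {..m} E) y * measure (Q (B m) (B (Suc m)) (y m)) (E (Suc m)) \<partial>L m)"
        unfolding L_def using Suc.prems E by (intro markov_step[OF \<A> Q(1) X] B) auto
      also have "\<dots> = (\<integral>y. indicator (Pi\<^sub>E {..m} E) y * measure (Q' (B m) (B (Suc m)) (y m)) (E (Suc m)) \<partial>L' m)"
        using Suc kernel[of m] by simp
      also have "\<dots> = measure (L' (Suc m)) (Pi\<^sub>E {..Suc m} E)"
        unfolding L'_def using Suc.prems E by (intro markov_step[OF \<A> Q(2) X', symmetric] B) auto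
      finally show "emeasure (L (Suc m)) (Pi\<^sub>E {..Suc m} E) = emeasure (L' (Suc m)) (Pi\<^sub>E {..Suc m} E)"
        by (simp add: LS.emeasure_eq_measure LS'.emeasure_eq_measure)
    next
      show "range (\<lambda>_::nat. Pi\<^sub>E {..Suc m} (\<lambda>_. UNIV)) \<subseteq> prod_algebra {..Suc m} (\<lambda>_. borel :: real measure)"
        by (auto intro!: prod_algebraI_finite)
    qed (auto simp: space_PiM)
  qed
  then show ?thesis
    unfolding L_def L'_def by simp
qed

section \<open>Equality of the finite dimensional distributions\<close>

text \<open>The pieces of the flow ending at \<open>\<tau> 1, \<dots>, \<tau> k\<close> contribute \<open>ord ! 1, \<dots>, ord ! k\<close>. The flow starts at
  \<open>ord ! 0\<close>, which may be included in the union for \<open>k > 0\<close> because \<open>ord ! 0 \<subseteq> ord ! 1\<close>.\<close>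

lemma connecting_flow_values:
  assumes conn: "connects \<A> F \<A>' ord"
  obtains \<tau> where
    "\<forall>k<length ord. 0 \<le> \<tau> k \<and> \<tau> k \<le> fst F"
    "\<forall>k. Suc k < length ord \<longrightarrow> \<tau> k \<le> \<tau> (Suc k)"
    "\<forall>k<length ord. snd F (\<tau> k) = \<Union>(set (take (Suc k) ord))"
proof -
  define n where "n = length ord - 1"
  have ord: "consistent_ordering \<A> \<A>' ord"
    using conn by (simp add: connects_def)
  have \<A>': "finite_subsemilattice \<A> \<A>'" and "ord \<noteq> []" and zero: "ord ! 0 = least_set \<A>"
    and tl: "set (tl ord) = \<A>'"
    using ord by (simp_all add: consistent_ordering_def)
  have len: "length ord = Suc n" using \<open>ord \<noteq> []\<close> by (simp add: n_def)
  have "tl ord \<noteq> []" using tl \<A>' by (auto simp: finite_subsemilattice_def)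
  then have "0 < n" by (cases ord) (auto simp: n_def)
  then have "ord ! 1 \<in> \<A>'"
    using nth_mem[of 0 "tl ord"] tl len by (simp add: nth_tl)
  then have zero_sub: "ord ! 0 \<subseteq> ord ! 1"
    using \<A>' unfolding zero finite_subsemilattice_def by (intro least_set_subset) auto
  from conn obtain \<tau> \<phi> where pieces: "flow_pieces \<A> F n \<tau> \<phi>"
    and end_val: "\<And>i. i < n \<Longrightarrow> \<phi> (Suc i) (\<tau> (Suc i)) = ord ! Suc i"
    unfolding connects_def n_def by blast
  have \<tau>: "\<tau> 0 = 0" "\<tau> n = fst F" "\<And>i. i < n \<Longrightarrow> \<tau> i < \<tau> (Suc i)"
    and F0: "snd F 0 = least_set \<A>"
    and F: "\<And>i t. i < n \<Longrightarrow> t \<in> {\<tau> i..\<tau> (Suc i)} \<Longrightarrow>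
      snd F t = (\<Union>j\<in>{1..i}. \<phi> j (\<tau> j)) \<union> \<phi> (Suc i) t"
    using pieces unfolding flow_pieces_def by blast+
  have mono: "\<tau> k \<le> \<tau> l" if "k \<le> l" "l \<le> n" for k l
    using that
  proof (induction l rule: dec_induct)
    case (step m)
    then show ?case using \<tau>(3)[of m] by simp
  qed simp
  have take: "\<Union>(set (take (Suc k) ord)) = (\<Union>j\<in>{0..k}. ord ! j)" if "k \<le> n" for k
    using that len by (simp add: nth_image[symmetric] atLeast0LessThan[symmetric] atLeastLessThanSuc_atLeastAtMost)
  show ?thesis
  proof (rule that; intro allI impI)
    fix k assume "k < length ord"
    then have k: "k \<le> n" using len by simp
    show "0 \<le> \<tau> k \<and> \<tau> k \<le> fst F"
      using mono[of 0 k] mono[of k n] k \<tau>(1,2) by simp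
    show "snd F (\<tau> k) = \<Union>(set (take (Suc k) ord))"
    proof (cases k)
      case 0
      then show ?thesis using take[of 0] by (simp add: \<tau>(1) F0 zero)
    next
      case (Suc i)
      then have i: "i < n" using k by simp
      have "snd F (\<tau> k) = (\<Union>j\<in>{1..i}. \<phi> j (\<tau> j)) \<union> \<phi> (Suc i) (\<tau> (Suc i))"
        unfolding Suc using F[OF i] \<tau>(3)[OF i] by simp
      also have "\<dots> = (\<Union>j\<in>{1..k}. \<phi> j (\<tau> j))"
        unfolding Suc by (simp add: atLeastAtMostSuc_conv Un_commute)
      also have "\<dots> = (\<Union>j\<in>{1..k}. ord ! j)"
      proof (rule SUP_cong[OF refl])
        fix j assume "j \<in> {1..k}"
        then show "\<phi> j (\<tau> j) = ord ! j"
          using end_val[of "j - 1"] k by (cases j) auto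
      qed
      also have "\<dots> = (\<Union>j\<in>{0..k}. ord ! j)"
      proof
        have "ord ! 0 \<subseteq> (\<Union>j\<in>{1..k}. ord ! j)"
          using zero_sub Suc by (intro SUP_upper2[where i = 1]) auto
        moreover have "{0..k} = insert 0 {1..k}" by auto
        ultimately show "(\<Union>j\<in>{0..k}. ord ! j) \<subseteq> (\<Union>j\<in>{1..k}. ord ! j)" by simp
      qed auto
      finally show ?thesis by (simp add: take[OF k])
    qed
  next
    fix k assume "Suc k < length ord"
    then show "\<tau> k \<le> \<tau> (Suc k)" using mono[of k "Suc k"] len by simp
  qed
qed

lemma incl_excl_singleton: "incl_excl X [A] \<omega> = X A \<omega>"
  using incl_excl_snoc[of X "[]" A \<omega>] by (simp add: incl_excl_def)

lemma distr_ext_u_mem: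
  assumes \<A>: "indexing_collection \<A>" and X: "process \<A> M X" "additive_extension \<A> M X"
    and A: "A \<in> \<A>"
  shows "distr M borel (ext_u \<A> X A) = distr M borel (X A)"
proof (rule distr_cong_AE[OF refl refl])
  have "{} \<in> \<A>" using \<A> by (simp add: indexing_collection_def)
  then have "AE \<omega> in M. ext_u \<A> X (\<Union>(set [A])) \<omega> = incl_excl X [A] \<omega>"
    using X(2) A by (intro AE_ext_u_eq_incl_excl) (auto simp: additive_extension_def)
  then show "AE \<omega> in M. ext_u \<A> X A \<omega> = X A \<omega>"
    by (simp add: incl_excl_singleton)
  show "ext_u \<A> X A \<in> borel_measurable M"
    by (rule ext_u_borel_measurable[OF \<A> X(1) mem_fin_unions[OF A]])
  show "X A \<in> borel_measurable M"
    using X(1) A by (simp add: process_def)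
qed

text \<open>The coefficients \<open>c\<close> do not mention \<open>M\<close> or \<open>X\<close>, so the same linear map works for two
  different processes. The empty set, which belongs to no semilattice, gets zero coefficients
  because the process vanishes there almost surely.\<close>

lemma fdd_as_image_of_chain_law:
  assumes \<A>: "indexing_collection \<A>" and X: "process \<A> M X" "additive_extension \<A> M X"
    and I: "finite I" "I \<subseteq> \<A>"
    and ord: "set ord \<subseteq> \<A>" "length ord = Suc n"
    and c: "\<forall>A\<in>I - {{}}. \<forall>Z. Z A =
      (\<Sum>k<length ord. c A k * incl_excl (\<lambda>A (_ :: unit). Z A) (take (Suc k) ord) ())"
    and c_empty: "c {} = (\<lambda>_. 0)"
  shows "distr M (\<Pi>\<^sub>M A\<in>I. borel) (\<lambda>\<omega>. \<lambda>A\<in>I. X A \<omega>) =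
    distr (distr M (\<Pi>\<^sub>M k\<in>{..n}. borel) (\<lambda>\<omega>. \<lambda>k\<in>{..n}. ext_u \<A> X (\<Union>(set (take (Suc k) ord))) \<omega>))
      (\<Pi>\<^sub>M A\<in>I. borel) (\<lambda>y. \<lambda>A\<in>I. \<Sum>k\<le>n. c A k * y k)"
proof -
  let ?B = "\<lambda>k. \<Union>(set (take (Suc k) ord))"
  let ?G = "\<lambda>y. \<lambda>A\<in>I. \<Sum>k\<le>n. c A k * y k"
  have empty: "{} \<in> \<A>" using \<A> by (simp add: indexing_collection_def)
  have take: "take (Suc k) ord \<noteq> []" "set (take (Suc k) ord) \<subseteq> \<A>" for k
    using ord set_take_subset[of "Suc k" ord] by auto
  have B: "?B k \<in> fin_unions \<A>" for k
    unfolding fin_unions_def using take(2)[of k] by blast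
  have Y: "ext_u \<A> X (?B k) \<in> borel_measurable M" for k
    by (rule ext_u_borel_measurable[OF \<A> X(1) B])
  have Yvec: "(\<lambda>\<omega>. \<lambda>k\<in>{..n}. ext_u \<A> X (?B k) \<omega>) \<in> M \<rightarrow>\<^sub>M (\<Pi>\<^sub>M k\<in>{..n}. borel)"
    by (intro measurable_restrict Y)
  have G: "?G \<in> (\<Pi>\<^sub>M k\<in>{..n}. borel) \<rightarrow>\<^sub>M (\<Pi>\<^sub>M A\<in>I. borel :: real measure)"
    by (intro measurable_restrict borel_measurable_sum borel_measurable_times
        borel_measurable_const measurable_component_singleton)
  have "AE \<omega> in M. \<forall>k\<in>{..n}. ext_u \<A> X (?B k) \<omega> = incl_excl X (take (Suc k) ord) \<omega>"
    using X(2) take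
    by (intro AE_finite_allI AE_ext_u_eq_incl_excl[OF empty]) (auto simp: additive_extension_def)
  moreover have "AE \<omega> in M. X {} \<omega> = 0"
    using X(2) by (simp add: additive_extension_def)
  ultimately have AE: "AE \<omega> in M. (\<lambda>A\<in>I. X A \<omega>) = ?G (\<lambda>k\<in>{..n}. ext_u \<A> X (?B k) \<omega>)"
  proof eventually_elim
    case (elim \<omega>)
    have "X A \<omega> = (\<Sum>k\<le>n. c A k * ext_u \<A> X (?B k) \<omega>)" if "A \<in> I" for A
    proof (cases "A = {}")
      case True
      then show ?thesis using elim c_empty by simp
    next
      case False
      then have "X A \<omega> = (\<Sum>k<length ord. c A k * incl_excl (\<lambda>A _. X A \<omega>) (take (Suc k) ord) ())"
        using c[THEN bspec, of A, THEN spec, of "\<lambda>A. X A \<omega>"] that by blast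
      also have "\<dots> = (\<Sum>k\<le>n. c A k * incl_excl X (take (Suc k) ord) \<omega>)"
        by (simp add: ord(2) lessThan_Suc_atMost incl_excl_def)
      also have "\<dots> = (\<Sum>k\<le>n. c A k * ext_u \<A> X (?B k) \<omega>)"
        using elim(1) by simp
      finally show ?thesis .
    qed
    then show ?case by (intro restrict_ext) simp
  qed
  have "distr M (\<Pi>\<^sub>M A\<in>I. borel) (\<lambda>\<omega>. \<lambda>A\<in>I. X A \<omega>) =
      distr M (\<Pi>\<^sub>M A\<in>I. borel) (?G \<circ> (\<lambda>\<omega>. \<lambda>k\<in>{..n}. ext_u \<A> X (?B k) \<omega>))"
  proof (rule distr_cong_AE[OF refl refl])
    show "AE \<omega> in M. (\<lambda>A\<in>I. X A \<omega>) = (?G \<circ> (\<lambda>\<omega>. \<lambda>k\<in>{..n}. ext_u \<A> X (?B k) \<omega>)) \<omega>"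
      using AE by (simp add: o_def)
    show "(\<lambda>\<omega>. \<lambda>A\<in>I. X A \<omega>) \<in> M \<rightarrow>\<^sub>M (\<Pi>\<^sub>M A\<in>I. borel)"
      using X(1) I by (intro measurable_restrict) (auto simp: process_def)
  qed (rule measurable_comp[OF Yvec G])
  then show ?thesis
    by (simp only: distr_distr[OF G Yvec])
qed

theorem corollary2:
  fixes \<A> :: "'t::t2_space set set"
    and \<S> :: "'t flow set"
    and Q Q' :: "'t transitions"
    and M :: "'w measure" and X :: "'t set \<Rightarrow> 'w \<Rightarrow> real"
    and M' :: "'v measure" and X' :: "'t set \<Rightarrow> 'v \<Rightarrow> real"
    and D D' :: "bmfun set"
  assumes "indexing_collection \<A>"
    and "flow_collection \<A> \<S>"
    and "transition_system \<A> Q" and "transition_system \<A> Q'"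
    and "markov_process \<A> Q M X" and "markov_process \<A> Q' M' X'"
    and "distr M borel (X (least_set \<A>)) = distr M' borel (X' (least_set \<A>))"
    and "has_generator \<S> Q D" and "has_generator \<S> Q' D'"
    and "\<forall>F\<in>\<S>. \<forall>s\<in>{0..fst F}. generator Q D F s = generator Q' D' F s"
  shows "same_fdd \<A> M X M' X'"
  unfolding same_fdd_def
proof (intro allI impI, elim conjE)
  fix I assume I: "finite I" "I \<subseteq> \<A>"
  note \<A> = assms(1) and Q = assms(3,4) and X = assms(5,6)
  have proc: "process \<A> M X" "process \<A> M' X'"
    and add: "additive_extension \<A> M X" "additive_extension \<A> M' X'"
    using X by (simp_all add: markov_process_def)
  obtain \<A>' where \<A>': "finite_subsemilattice \<A> \<A>'" "I - {{}} \<subseteq> \<A>'"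
    using finite_subsemilattice_superset[OF \<A> I] by blast
  obtain ord where ord: "consistent_ordering \<A> \<A>' ord"
    using consistent_ordering_exists[OF \<A>'(1)] by blast
  obtain F where F: "F \<in> \<S>" "connects \<A> F \<A>' ord"
  proof -
    obtain sel where sel: "\<forall>\<A>' ord. consistent_ordering \<A> \<A>' ord \<longrightarrow> connects \<A> (sel \<A>' ord) \<A>' ord"
      and \<S>: "\<S> = {sel \<A>' ord | \<A>' ord. consistent_ordering \<A> \<A>' ord}"
      using assms(2) unfolding flow_collection_def by (elim exE conjE)
    show ?thesis
    proof (rule that)
      show "sel \<A>' ord \<in> \<S>" unfolding \<S> using ord by blast
      show "connects \<A> (sel \<A>' ord) \<A>' ord" using sel ord by simp
    qed
  qed
  have simple: "simple_flow \<A> F" using F(2) by (simp add: connects_def)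
  then have flow: "flow_on (fin_unions \<A>) 0 (fst F) (snd F)" by (simp add: simple_flow_def)
  obtain m \<sigma> \<phi> where "flow_pieces \<A> F m \<sigma> \<phi>"
    using simple unfolding simple_flow_def by blast
  then have F0: "snd F 0 = least_set \<A>" by (simp add: flow_pieces_def)
  define n where "n = length ord - 1"
  have ord_ne: "ord \<noteq> []" and ord0: "ord ! 0 = least_set \<A>" and tl: "set (tl ord) = \<A>'"
    using ord by (simp_all add: consistent_ordering_def)
  then have len: "length ord = Suc n" by (simp add: n_def)
  have set_ord: "set ord = insert (least_set \<A>) \<A>'"
    using ord_ne ord0 tl by (cases ord) auto
  then have ord_sub: "set ord \<subseteq> \<A>"
    using \<A>'(1) least_set_mem(1)[OF \<A>] by (auto simp: finite_subsemilattice_def)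
  define B where "B k = \<Union>(set (take (Suc k) ord))" for k
  obtain \<tau> where \<tau>: "\<forall>k<length ord. 0 \<le> \<tau> k \<and> \<tau> k \<le> fst F"
    "\<forall>k. Suc k < length ord \<longrightarrow> \<tau> k \<le> \<tau> (Suc k)"
    and "\<forall>k<length ord. snd F (\<tau> k) = \<Union>(set (take (Suc k) ord))"
    by (rule connecting_flow_values[OF F(2)])
  then have F\<tau>: "snd F (\<tau> k) = B k" if "k < length ord" for k
    using that by (simp add: B_def)
  have "take (Suc 0) ord = [least_set \<A>]"
    using ord_ne ord0 by (cases ord) auto
  then have B0: "B 0 = least_set \<A>"
    by (simp add: B_def)
  have chain: "distr M (\<Pi>\<^sub>M k\<in>{..n}. borel) (\<lambda>\<omega>. \<lambda>k\<in>{..n}. ext_u \<A> X (B k) \<omega>) =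
    distr M' (\<Pi>\<^sub>M k\<in>{..n}. borel) (\<lambda>\<omega>. \<lambda>k\<in>{..n}. ext_u \<A> X' (B k) \<omega>)"
  proof (rule markov_chain_law_eq[OF \<A> Q X])
    show "distr M borel (ext_u \<A> X (B 0)) = distr M' borel (ext_u \<A> X' (B 0))"
      using assms(7) distr_ext_u_mem[OF \<A> proc(1) add(1) least_set_mem(1)[OF \<A>]]
        distr_ext_u_mem[OF \<A> proc(2) add(2) least_set_mem(1)[OF \<A>]] by (simp add: B0)
    show "B 0 \<noteq> {}" using B0 least_set_mem(2)[OF \<A>] by simp
  next
    fix k assume "k \<le> n"
    then show "B k \<in> fin_unions \<A>"
      unfolding B_def fin_unions_def using ord_sub set_take_subset[of "Suc k" ord] by blast
  next
    fix k assume k: "k < n"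
    show "B k \<subseteq> B (Suc k)"
      unfolding B_def by (intro Union_mono set_take_subset_set_take) simp
    show "Q (B k) (B (Suc k)) x = Q' (B k) (B (Suc k)) x" for x
    proof -
      have "Q (snd F (\<tau> k)) (snd F (\<tau> (Suc k))) x = Q' (snd F (\<tau> k)) (snd F (\<tau> (Suc k))) x"
      proof (rule transition_kernels_eq[OF Q flow _ F(1) assms(8,9)])
        show "snd F 0 \<noteq> {}" using F0 least_set_mem(2)[OF \<A>] by simp
        show "\<forall>s\<in>{0..fst F}. generator Q D F s = generator Q' D' F s"
          using assms(10) F(1) by blast
      qed (use \<tau> k len in auto)
      then show ?thesis using F\<tau>[of k] F\<tau>[of "Suc k"] k len by simp
    qed
  qed
  have "\<forall>A\<in>I - {{}}. \<exists>c. \<forall>Z. Z A =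
      (\<Sum>k<length ord. c k * incl_excl (\<lambda>A (_ :: unit). Z A) (take (Suc k) ord) ())"
  proof
    fix A assume "A \<in> I - {{}}"
    then have "A \<in> set ord" using \<A>'(2) set_ord by blast
    then obtain i where i: "i < length ord" "ord ! i = A" by (auto simp: in_set_conv_nth)
    show "\<exists>c. \<forall>Z. Z A = (\<Sum>k<length ord. c k * incl_excl (\<lambda>A (_ :: unit). Z A) (take (Suc k) ord) ())"
      using lin_comb_nth[OF consistent_ordering_Int[OF ord] i(1)] unfolding lin_comb_def i(2) .
  qed
  from bchoice[OF this] obtain c0 where c0: "\<forall>A\<in>I - {{}}. \<forall>Z. Z A =
      (\<Sum>k<length ord. c0 A k * incl_excl (\<lambda>A (_ :: unit). Z A) (take (Suc k) ord) ())" ..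
  define c where "c = c0({} := \<lambda>_. 0)"
  have c: "\<forall>A\<in>I - {{}}. \<forall>Z. Z A =
      (\<Sum>k<length ord. c A k * incl_excl (\<lambda>A (_ :: unit). Z A) (take (Suc k) ord) ())"
  proof
    fix A assume A: "A \<in> I - {{}}"
    then have "c A = c0 A" by (simp add: c_def)
    then show "\<forall>Z. Z A = (\<Sum>k<length ord. c A k * incl_excl (\<lambda>A (_ :: unit). Z A) (take (Suc k) ord) ())"
      using bspec[OF c0 A] by simp
  qed
  have c_empty: "c {} = (\<lambda>_. 0)" by (simp add: c_def)
  show "distr M (\<Pi>\<^sub>M A\<in>I. borel) (\<lambda>\<omega>. \<lambda>A\<in>I. X A \<omega>) =
      distr M' (\<Pi>\<^sub>M A\<in>I. borel) (\<lambda>\<omega>. \<lambda>A\<in>I. X' A \<omega>)"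
    unfolding fdd_as_image_of_chain_law[OF \<A> proc(1) add(1) I ord_sub len c c_empty]
      fdd_as_image_of_chain_law[OF \<A> proc(2) add(2) I ord_sub len c c_empty]
    by (simp only: chain[unfolded B_def])
qed

end
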